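(* Let $\xi\in(\mathbb{Z}/2\mathbb{Z})^2$, $\eta\in\mathbb{Z}/2\mathbb{Z}$, $\lambda\in\mathbb{C}^2$, $\nu\in\mathbb{C}$. If both $\lambda_1-\nu+\frac n2+[\xi_1+\eta]\in-2\mathbb{N}$ and $\nu-\lambda_2+\frac n2+[\xi_2+\eta]\in-2\mathbb{N}$, then $\mathbf{B}_{\xi,\lambda}^{\eta,\nu}=0$.
   Context: $\mathbb{N}=\{0,1,2,\ldots\}$. For $\varepsilon\in\mathbb{Z}/2\mathbb{Z}$, $\mu\in\mathbb{C}$, $x\in\mathbb{R}^\times$ put $|x|_\varepsilon^\mu=\operatorname{sgn}(x)^\varepsilon|x|^\mu$; $[\varepsilon]\in\{0,1\}$ denotes the representative of $\varepsilon$; $E_{i,j}$ is the elementary matrix. Let $G=\mathrm{GL}(2n,\mathbb{R})$ and $H=\mathrm{GL}(2n-1,\mathbb{R})\subseteq G$ (upper left corner). $\pi_{\xi,\lambda}$ is the left regular representation of $G$ on the space of $f\in C^\infty(G)$ with $f\big(g\begin{pmatrix}g_1&*\\0&g_2\end{pmatrix}\big)=|\det g_1|_{\xi_1}^{-\lambda_1-\frac n2}|\det g_2|_{\xi_2}^{-\lambda_2+\frac n2}f(g)$, $g_1,g_2\in\mathrm{GL}(n,\mathbb{R})$. $\mathbf{B}_{\xi,\lambda}^{\eta,\nu}$ is the family of operators from $\pi_{\xi,\lambda}$ to smooth functions on $H$ obtained by holomorphic continuation in $(\lambda,\nu)\in\mathbb{C}^2\times\mathbb{C}$ (in the compact picture,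 i.e. for fixed restriction of $f$ to $O(2n)$) of $$\mathbf{B}_{\xi,\lambda}^{\eta,\nu}f(h)=\Gamma\big(\tfrac{\lambda_1-\nu+\frac n2+[\xi_1+\eta]}{2}\big)^{-1}\Gamma\big(\tfrac{\nu-\lambda_2+\frac n2+[\xi_2+\eta]}{2}\big)^{-1}\int_{\mathbb{R}^\times}|t|_{\xi_1+\eta}^{\lambda_1-\nu+\frac n2}f\big(h(I_{2n}+tE_{2n,n})\big)\frac{dt}{|t|}\qquad(h\in H),$$ the integral converging for $\operatorname{Re}(\lambda_1-\nu)>-\frac n2$, $\operatorname{Re}(\nu-\lambda_2)>-\frac n2$. *)

theory Defs
  imports "HOL-Analysis.Analysis" "HOL-Library.Z2"
begin

text \<open>
  The group \<open>GL(2n,\<real>)\<close> consists of the invertible matrices of the following type, where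
  \<open>n = CARD('n)\<close>. The rows and columns \<open>1,\<dots>,n\<close> are the indices \<open>Inl i\<close>, and
  \<open>n+1,\<dots>,2n\<close> are the indices \<open>Inr i\<close>; the order on \<open>'n\<close> singles out the last index
  of each block.
\<close>

type_synonym 'n mat2 = "real^('n + 'n)^('n + 'n)"

definition GL :: "(real^'m^'m) set" where
  "GL = {g. invertible g}"

text \<open>\<open>GL(2n-1,\<real>)\<close> in the upper left corner, as the matrices \<open>diag(h', 1)\<close>.\<close>

definition GL_corner :: "'n::{finite,linorder} mat2 set" where
  "GL_corner = {h \<in> GL. \<forall>i.
      h $ i $ Inr (Max UNIV) = (if i = Inr (Max UNIV) then 1 else 0) \<and>
      h $ Inr (Max UNIV) $ i = (if i = Inr (Max UNIV) then 1 else 0)}"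

definition upper_block :: "real^'n^'n \<Rightarrow> real^'n^'n \<Rightarrow> real^'n^'n \<Rightarrow> 'n mat2" where
  "upper_block g1 X g2 = (\<chi> i j. case i of
      Inl a \<Rightarrow> (case j of Inl b \<Rightarrow> g1 $ a $ b | Inr b \<Rightarrow> X $ a $ b)
    | Inr a \<Rightarrow> (case j of Inl b \<Rightarrow> 0 | Inr b \<Rightarrow> g2 $ a $ b))"

text \<open>The elementary matrix \<open>E\<^bsub>2n,n\<^esub>\<close>.\<close>

definition E_last :: "'n::{finite,linorder} mat2" where
  "E_last = (\<chi> i j. if i = Inr (Max UNIV) \<and> j = Inl (Max UNIV) then 1 else 0)"

text \<open>The representative \<open>[\<epsilon>] \<in> {0,1}\<close> of \<open>\<epsilon> \<in> \<int>/2\<int>\<close>.\<close>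

definition rep :: "bit \<Rightarrow> nat" where
  "rep \<epsilon> = (if \<epsilon> = 1 then 1 else 0)"

text \<open>\<open>|x|\<^bsub>\<epsilon>\<^esub>\<^bsup>\<mu>\<^esup>\<close>, only meaningful for \<open>x \<noteq> 0\<close>.\<close>

definition sabs :: "bit \<Rightarrow> complex \<Rightarrow> real \<Rightarrow> complex" where
  "sabs \<epsilon> \<mu> x = of_real (sgn x) ^ rep \<epsilon> * of_real \<bar>x\<bar> powr \<mu>"

text \<open>\<open>C\<^sup>k\<close> and \<open>C\<^sup>\<infinity>\<close> functions on an open set, via iterated directional derivatives.\<close>

fun Ck_on :: "nat \<Rightarrow> 'a::euclidean_space set \<Rightarrow> ('a \<Rightarrow> 'b::real_normed_vector) \<Rightarrow> bool" where
  "Ck_on 0 S f \<longleftrightarrow> continuous_on S f"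
| "Ck_on (Suc k) S f \<longleftrightarrow> (\<forall>x\<in>S. f differentiable (at x)) \<and>
     (\<forall>v. Ck_on k S (\<lambda>x. frechet_derivative f (at x) v))"

definition Cinf_on :: "'a::euclidean_space set \<Rightarrow> ('a \<Rightarrow> 'b::real_normed_vector) \<Rightarrow> bool" where
  "Cinf_on S f \<longleftrightarrow> (\<forall>k. Ck_on k S f)"

text \<open>
  The space of \<open>\<pi>\<^bsub>\<xi>,\<lambda>\<^esub>\<close> with \<open>\<xi> = (x1, x2)\<close>, \<open>\<lambda> = (l1, l2)\<close>. Functions on \<open>G\<close> are functions
  on all matrices whose values outside \<open>GL\<close> are irrelevant.
\<close>

definition principal_series ::
  "bit \<Rightarrow> bit \<Rightarrow> complex \<Rightarrow> complex \<Rightarrow> ('n::finite mat2 \<Rightarrow> complex) set" where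
  "principal_series x1 x2 l1 l2 = {f. Cinf_on GL f \<and>
     (\<forall>g\<in>GL. \<forall>g1\<in>GL. \<forall>g2\<in>GL. \<forall>X.
        f (g ** upper_block g1 X g2) =
          sabs x1 (- l1 - of_nat CARD('n) / 2) (det g1) *
          sabs x2 (- l2 + of_nat CARD('n) / 2) (det g2) * f g)}"

text \<open>The normalized integral; \<open>rGamma\<close> is the reciprocal Gamma function.\<close>

definition B_integral ::
  "bit \<Rightarrow> bit \<Rightarrow> bit \<Rightarrow> complex \<Rightarrow> complex \<Rightarrow> complex \<Rightarrow>
     ('n::{finite,linorder} mat2 \<Rightarrow> complex) \<Rightarrow> 'n mat2 \<Rightarrow> complex" where
  "B_integral x1 x2 e l1 l2 nu f h =
     rGamma ((l1 - nu + of_nat CARD('n) / 2 + of_nat (rep (x1 + e))) / 2) *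
     rGamma ((nu - l2 + of_nat CARD('n) / 2 + of_nat (rep (x2 + e))) / 2) *
     (LBINT t:- {0}. sabs (x1 + e) (l1 - nu + of_nat CARD('n) / 2) t *
        f (h ** (mat 1 + t *\<^sub>R E_last)) / of_real \<bar>t\<bar>)"

text \<open>
  Holomorphic functions on all of \<open>\<complex>\<^sup>3\<close>: jointly continuous and holomorphic in each
  variable separately.
\<close>

definition entire3 :: "(complex \<Rightarrow> complex \<Rightarrow> complex \<Rightarrow> complex) \<Rightarrow> bool" where
  "entire3 F \<longleftrightarrow>
     continuous_on UNIV (\<lambda>(a, b, c). F a b c) \<and>
     (\<forall>b c. (\<lambda>a. F a b c) holomorphic_on UNIV) \<and>
     (\<forall>a c. (\<lambda>b. F a b c) holomorphic_on UNIV) \<and>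
     (\<forall>a b. (\<lambda>c. F a b c) holomorphic_on UNIV)"

text \<open>
  Continuation in the compact picture: the restriction of \<open>f\<close> to \<open>O(2n)\<close> is kept fixed, so that
  at the parameter \<open>(m1, m2, c)\<close> of the domain of convergence the integral is applied to the
  element \<open>f'\<close> of \<open>\<pi>\<^bsub>\<xi>,(m1,m2)\<^esub>\<close> having that restriction. By the Iwasawa decomposition \<open>f'\<close> exists,
  and it is unique on \<open>GL\<close>.
\<close>

definition B_continuation ::
  "bit \<Rightarrow> bit \<Rightarrow> bit \<Rightarrow> ('n::{finite,linorder} mat2 \<Rightarrow> complex) \<Rightarrow> 'n mat2 \<Rightarrow>
     (complex \<Rightarrow> complex \<Rightarrow> complex \<Rightarrow> complex) \<Rightarrow> bool" where
  "B_continuation x1 x2 e f h F \<longleftrightarrow> entire3 F \<and>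
     (\<forall>m1 m2 c f'.
        Re (m1 - c) > - real CARD('n) / 2 \<longrightarrow> Re (c - m2) > - real CARD('n) / 2 \<longrightarrow>
        f' \<in> principal_series x1 x2 m1 m2 \<longrightarrow> (\<forall>k. orthogonal_matrix k \<longrightarrow> f' k = f k) \<longrightarrow>
        F m1 m2 c = B_integral x1 x2 e m1 m2 c f' h)"

text \<open>
  The operator \<open>\<^bold>B\<close> for \<open>\<xi> = (x1, x2)\<close>, \<open>\<eta> = e\<close>, \<open>\<lambda> = (l1, l2)\<close>, \<open>\<nu> = nu\<close>, applied to
  \<open>f \<in> \<pi>\<^bsub>\<xi>,\<lambda>\<^esub>\<close> and evaluated at \<open>h\<close>.
\<close>

definition B_op ::
  "bit \<Rightarrow> bit \<Rightarrow> bit \<Rightarrow> complex \<Rightarrow> complex \<Rightarrow> complex \<Rightarrow>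
     ('n::{finite,linorder} mat2 \<Rightarrow> complex) \<Rightarrow> 'n mat2 \<Rightarrow> complex" where
  "B_op x1 x2 e l1 l2 nu f h = (THE F. B_continuation x1 x2 e f h F) l1 l2 nu"

definition neg_evens :: "complex set" where
  "neg_evens = {- 2 * of_nat k | k. True}"

end

theory Submission
  imports Defs "HOL-Complex_Analysis.Complex_Analysis" "HOL-Real_Asymp.Real_Asymp"
begin

text \<open>
  Put \<open>s\<^sub>1 = \<lambda>\<^sub>1 - \<nu> + n/2\<close>, \<open>s\<^sub>2 = \<nu> - \<lambda>\<^sub>2 + n/2\<close>, \<open>\<epsilon>\<^sub>1 = \<xi>\<^sub>1 + \<eta>\<close> and
  \<open>\<epsilon>\<^sub>2 = \<xi>\<^sub>2 + \<eta>\<close>. The line \<open>t \<mapsto> h (I + t E)\<close> has a second smooth chart at \<open>t = \<infinity>\<close>: up to right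
  multiplication by a block upper triangular matrix, \<open>I + E/u\<close> equals a matrix that is affine in \<open>u\<close> and
  invertible also at \<open>u = 0\<close>. The equivariance of \<open>f\<close> turns the part \<open>\<bar>t\<bar> > 1\<close> of the integral into an
  integral over \<open>\<bar>u\<bar> < 1\<close> of the same shape (lemma \<open>integrand_inversion\<close>), with \<open>(s\<^sub>1, \<epsilon>\<^sub>1)\<close> replaced
  by \<open>(s\<^sub>2, \<epsilon>\<^sub>2)\<close>. So the unnormalized integral is \<open>I\<^sub>1 + I\<^sub>2\<close>, where \<open>I\<^sub>j\<close> is a Mellin integral
  over a neighbourhood of \<open>0\<close> of a smooth function against \<open>\<bar>t\<bar>\<^sup>s dt/\<bar>t\<bar>\<close> with the sign character \<open>\<epsilon>\<^sub>j\<close>.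

  Only the part of the smooth function with the parity of \<open>\<epsilon>\<^sub>j\<close> contributes, so \<open>I\<^sub>j\<close> has at most simple poles,
  at \<open>s\<^sub>j + [\<epsilon>\<^sub>j] \<in> -2\<nat>\<close>, and \<open>\<Gamma>((s\<^sub>j + [\<epsilon>\<^sub>j])/2)\<inverse> I\<^sub>j\<close> is entire. The normalized operator is therefore
  \<open>\<Gamma>((s\<^sub>2 + [\<epsilon>\<^sub>2])/2)\<inverse> A\<^sub>1 + \<Gamma>((s\<^sub>1 + [\<epsilon>\<^sub>1])/2)\<inverse> A\<^sub>2\<close>
  with entire \<open>A\<^sub>1\<close>, \<open>A\<^sub>2\<close> (this shape is recorded in lemma \<open>B_continuation_exists\<close>), and under the hypotheses both reciprocal
  Gamma factors vanish.

  In the compact picture the parameters move while the restriction of \<open>f\<close> to \<open>O(2n)\<close> stays fixed. Let \<open>Q(g)\<close> be the Gram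
  determinant of the first \<open>n\<close> columns of \<open>g\<close>. It is smooth and positive, equals \<open>1\<close> on \<open>O(2n)\<close>, and is multiplied by
  \<open>(det g\<^sub>1)\<^sup>2\<close> under right translation by a block upper triangular matrix with diagonal blocks \<open>g\<^sub>1\<close>, \<open>g\<^sub>2\<close>.
  Hence the function with parameters \<open>(m\<^sub>1, m\<^sub>2)\<close> is \<open>f\<close> times a power of \<open>Q\<close> times a power of \<open>(det g)\<^sup>2\<close>, with
  exponents that are affine in \<open>(m\<^sub>1, m\<^sub>2)\<close>. Along both charts \<open>Q\<close> is an even function \<open>q\<close> of the
  coordinate, so that everything reduces to integrals \<open>\<integral> t\<^sup>s\<^sup>-\<^sup>1 f(t) q(t)\<^sup>w dt\<close> over \<open>[0,1]\<close> with \<open>f\<close> even. Integration by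
  parts expresses such an integral through two integrals of the same kind at \<open>s + 2\<close>, and this recursion gives
  the entire continuation in \<open>(s, w)\<close> (locale \<open>even_weight\<close>).

  The operator is defined through the unique continuation, so uniqueness is part of the argument: two continuations
  agree on the domain of convergence, where every pair \<open>(m\<^sub>1, m\<^sub>2)\<close> is realized by the function just described,
  and hence everywhere by the identity theorem in one variable at a time (lemma \<open>B_continuation_unique\<close>).
\<close>

unbundle no fps_syntax

section \<open>Calculus of differentiable functions of finite order\<close>

lemma Ck_on_Suc_derivative:
  "Ck_on (Suc k) S f \<Longrightarrow> x \<in> S \<Longrightarrow> (f has_derivative frechet_derivative f (at x)) (at x)"
  by (simp add: frechet_derivative_works)

text \<open>
  The recursion in \<open>Ck_on\<close> passes through Frechet derivatives, which depend on the values near a point only; this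
  is where openness of the set enters.
\<close>

lemma Ck_on_cong:
  fixes f g :: "'a::euclidean_space \<Rightarrow> 'b::real_normed_vector"
  assumes "open S" "\<And>x. x \<in> S \<Longrightarrow> f x = g x"
  shows "Ck_on k S f \<longleftrightarrow> Ck_on k S g"
  using assms(2)
proof (induction k arbitrary: f g)
  case 0
  then show ?case using continuous_on_cong[of S S f g] by simp
next
  case (Suc k)
  have imp: "Ck_on (Suc k) S v" if "Ck_on (Suc k) S u" "\<And>x. x \<in> S \<Longrightarrow> u x = v x" for u v :: "'a \<Rightarrow> 'b"
  proof -
    have d: "(v has_derivative frechet_derivative u (at x)) (at x)" if "x \<in> S" for x
      by (rule has_derivative_transform_within_open
          [OF Ck_on_Suc_derivative[OF \<open>Ck_on (Suc k) S u\<close> that] assms(1) that])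
        (fact \<open>\<And>x. x \<in> S \<Longrightarrow> u x = v x\<close>)
    have "frechet_derivative u (at x) = frechet_derivative v (at x)" if "x \<in> S" for x
      using frechet_derivative_at[OF d[OF that]] .
    then have "Ck_on k S (\<lambda>x. frechet_derivative u (at x) w)
        = Ck_on k S (\<lambda>x. frechet_derivative v (at x) w)" for w
      by (intro Suc.IH) simp
    then show ?thesis using that(1) d by (auto simp: differentiable_def)
  qed
  show ?case
  proof
    show "Ck_on (Suc k) S g" if "Ck_on (Suc k) S f" using imp[OF that Suc.prems] .
    show "Ck_on (Suc k) S f" if "Ck_on (Suc k) S g" using imp[OF that Suc.prems[symmetric]] .
  qed
qed

lemma Ck_on_SucI:
  assumes "open S" "\<And>x. x \<in> S \<Longrightarrow> (f has_derivative f' x) (at x)" "\<And>v. Ck_on k S (\<lambda>x. f' x v)"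
  shows "Ck_on (Suc k) S f"
proof -
  have "frechet_derivative f (at x) = f' x" if "x \<in> S" for x
    using frechet_derivative_at[OF assms(2)[OF that]] by simp
  then have "Ck_on k S (\<lambda>x. frechet_derivative f (at x) v)" for v
    using assms(3)[of v] Ck_on_cong[OF assms(1), of "\<lambda>x. frechet_derivative f (at x) v"] by simp
  with assms(2) show ?thesis by (auto simp: differentiable_def)
qed

lemma Ck_on_SucD: "Ck_on (Suc k) S f \<Longrightarrow> Ck_on k S f"
proof (induction k arbitrary: f)
  case 0
  then show ?case
    by (auto intro!: continuous_at_imp_continuous_on differentiable_imp_continuous_within)
next
  case (Suc k)
  then show ?case by (metis Ck_on.simps(2))
qed

lemma Ck_on_const: "Ck_on k S (\<lambda>x. c)"
  by (induction k arbitrary: c) auto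

lemma Ck_on_linear:
  assumes "bounded_linear f" "open S" shows "Ck_on k S f"
proof (cases k)
  case 0 then show ?thesis using assms by (simp add: linear_continuous_on)
next
  case (Suc m)
  show ?thesis unfolding Suc
    by (rule Ck_on_SucI[OF assms(2), where f' = "\<lambda>_. f"])
      (auto intro: bounded_linear_imp_has_derivative assms Ck_on_const)
qed

lemma Ck_on_add:
  assumes "open S" "Ck_on k S f" "Ck_on k S g" shows "Ck_on k S (\<lambda>x. f x + g x)"
  using assms(2,3)
proof (induction k arbitrary: f g)
  case 0 then show ?case by (auto intro: continuous_intros)
next
  case (Suc k)
  show ?case
  proof (rule Ck_on_SucI[OF assms(1), where
        f' = "\<lambda>x v. frechet_derivative f (at x) v + frechet_derivative g (at x) v"])
    show "((\<lambda>x. f x + g x) has_derivative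
       (\<lambda>v. frechet_derivative f (at x) v + frechet_derivative g (at x) v)) (at x)" if "x \<in> S" for x
      by (rule has_derivative_add[OF Ck_on_Suc_derivative[OF Suc.prems(1) that] Ck_on_Suc_derivative[OF Suc.prems(2) that]])
    show "Ck_on k S (\<lambda>x. frechet_derivative f (at x) v + frechet_derivative g (at x) v)" for v
      using Suc.prems by (intro Suc.IH) auto
  qed
qed

lemma Ck_on_bilinear:
  assumes "bounded_bilinear p" "open S" "Ck_on k S f" "Ck_on k S g"
  shows "Ck_on k S (\<lambda>x. p (f x) (g x))"
  using assms(3,4)
proof (induction k arbitrary: f g)
  case 0 then show ?case using assms(1) by (auto intro: bounded_bilinear.continuous_on)
next
  case (Suc k)
  show ?case
  proof (rule Ck_on_SucI[OF assms(2), where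
        f' = "\<lambda>x v. p (f x) (frechet_derivative g (at x) v) + p (frechet_derivative f (at x) v) (g x)"])
    show "((\<lambda>x. p (f x) (g x)) has_derivative
       (\<lambda>v. p (f x) (frechet_derivative g (at x) v) + p (frechet_derivative f (at x) v) (g x))) (at x)"
      if "x \<in> S" for x
      by (rule bounded_bilinear.FDERIV[OF assms(1) Ck_on_Suc_derivative[OF Suc.prems(1) that] Ck_on_Suc_derivative[OF Suc.prems(2) that]])
    show "Ck_on k S (\<lambda>x. p (f x) (frechet_derivative g (at x) v) + p (frechet_derivative f (at x) v) (g x))" for v
      using Suc.prems Ck_on_SucD[OF Suc.prems(1)] Ck_on_SucD[OF Suc.prems(2)]
      by (intro Suc.IH Ck_on_add assms) auto
  qed
qed

lemmas Ck_on_mult = Ck_on_bilinear[OF bounded_bilinear_mult]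

lemma Ck_on_sum:
  assumes "open S" "\<And>i. i \<in> I \<Longrightarrow> Ck_on k S (f i)" shows "Ck_on k S (\<lambda>x. \<Sum>i\<in>I. f i x)"
  using assms(2) by (induction I rule: infinite_finite_induct) (auto intro: Ck_on_const Ck_on_add assms)

lemma Ck_on_prod:
  fixes f :: "'i \<Rightarrow> 'a::euclidean_space \<Rightarrow> 'b::real_normed_field"
  assumes "open S" "\<And>i. i \<in> I \<Longrightarrow> Ck_on k S (f i)" shows "Ck_on k S (\<lambda>x. \<Prod>i\<in>I. f i x)"
  using assms(2) by (induction I rule: infinite_finite_induct) (auto intro: Ck_on_const Ck_on_mult assms)

text \<open>
  The derivative of \<open>q\<^sup>a\<close> is a derivative of \<open>q\<close> times \<open>a q\<^sup>a\<^sup>-\<^sup>1\<close>, so the induction has to run over all exponents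
  at once.
\<close>

lemma Ck_on_powr:
  fixes q :: "'a::euclidean_space \<Rightarrow> real"
  assumes S: "open S" and q: "Ck_on k S q" "\<And>x. x \<in> S \<Longrightarrow> q x > 0"
  shows "Ck_on k S (\<lambda>x. complex_of_real (q x) powr a)"
  using q(1)
proof (induction k arbitrary: a)
  case 0
  then show ?case using q(2)
    by (fastforce intro!: continuous_on_powr_complex continuous_intros)
next
  case (Suc k)
  let ?q' = "\<lambda>x. frechet_derivative q (at x)"
  show ?case
  proof (rule Ck_on_SucI[OF S, where
        f' = "\<lambda>x v. complex_of_real (?q' x v) * (a * complex_of_real (q x) powr (a - 1))"])
    show "((\<lambda>x. complex_of_real (q x) powr a) has_derivative
        (\<lambda>v. complex_of_real (?q' x v) * (a * complex_of_real (q x) powr (a - 1)))) (at x)"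
      if "x \<in> S" for x
    proof -
      have 1: "((\<lambda>x. complex_of_real (q x)) has_derivative (\<lambda>v. complex_of_real (?q' x v))) (at x)"
        by (rule has_derivative_of_real[OF Ck_on_Suc_derivative[OF Suc.prems that]])
      have 2: "((\<lambda>z. z powr a) has_field_derivative a * complex_of_real (q x) powr (a - 1))
          (at (complex_of_real (q x)))"
        using q(2)[OF that] by (auto intro!: has_field_derivative_powr simp: complex_nonpos_Reals_iff)
      show ?thesis
        using has_derivative_compose[OF 1 2[unfolded has_field_derivative_def]]
        by (simp add: mult.commute)
    qed
    have "Ck_on k S (\<lambda>x. complex_of_real (?q' x v))" for v
    proof -
      have "Ck_on k S (\<lambda>x. ?q' x v)" using Suc.prems by simp
      from Ck_on_bilinear[OF bounded_bilinear_scaleR S this Ck_on_const[of k S "1::complex"]]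
      show ?thesis by (simp add: scaleR_conv_of_real)
    qed
    then show "Ck_on k S (\<lambda>x. complex_of_real (?q' x v) * (a * complex_of_real (q x) powr (a - 1)))" for v
      using Suc.IH[OF Ck_on_SucD[OF Suc.prems]] by (intro Ck_on_mult S Ck_on_const)
  qed
qed

lemma Ck_on_entry: "open S \<Longrightarrow> Ck_on k S (\<lambda>g::real^'m^'l. g $ i $ j)"
  by (intro Ck_on_linear bounded_linear_compose[OF bounded_linear_vec_nth bounded_linear_vec_nth])

lemma Ck_on_det:
  fixes A :: "'a::euclidean_space \<Rightarrow> real^'m^'m"
  assumes "open S" "\<And>i j. Ck_on k S (\<lambda>x. A x $ i $ j)"
  shows "Ck_on k S (\<lambda>x. det (A x))"
  unfolding det_def by (intro Ck_on_sum Ck_on_mult Ck_on_prod Ck_on_const assms)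

section \<open>Even smooth functions on the line\<close>

lemma Cinf_on_mult:
  fixes f g :: "'a::euclidean_space \<Rightarrow> 'b::real_normed_algebra"
  shows "open S \<Longrightarrow> Cinf_on S f \<Longrightarrow> Cinf_on S g \<Longrightarrow> Cinf_on S (\<lambda>x. f x * g x)"
  by (simp add: Cinf_on_def Ck_on_mult)

lemma Cinf_on_add: "open S \<Longrightarrow> Cinf_on S f \<Longrightarrow> Cinf_on S g \<Longrightarrow> Cinf_on S (\<lambda>x. f x + g x)"
  by (simp add: Cinf_on_def Ck_on_add)

lemma Cinf_on_of_real:
  fixes f :: "'a::euclidean_space \<Rightarrow> real"
  assumes "open S" "Cinf_on S f" shows "Cinf_on S (\<lambda>x. complex_of_real (f x))"
proof -
  have "Ck_on k S (\<lambda>x. f x *\<^sub>R (1::complex))" for k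
    using assms by (intro Ck_on_bilinear[OF bounded_bilinear_scaleR] Ck_on_const) (auto simp: Cinf_on_def)
  then show ?thesis by (simp add: Cinf_on_def scaleR_conv_of_real)
qed

text \<open>
  Each derivative of \<open>t \<mapsto> f (A + t B)\<close> is the same kind of function for the directional derivative of \<open>f\<close> along \<open>B\<close>.
\<close>

lemma Cinf_on_affine:
  fixes A B :: "'a::euclidean_space"
  assumes "Cinf_on S f" "\<And>t. A + t *\<^sub>R B \<in> S"
  shows "Cinf_on UNIV (\<lambda>t::real. f (A + t *\<^sub>R B))"
proof -
  have "Ck_on k UNIV (\<lambda>t::real. f (A + t *\<^sub>R B))" if "Ck_on k S f" for k
    using that
  proof (induction k arbitrary: f)
    case 0
    then show ?case using assms(2) by (auto intro!: continuous_on_compose2[of S f] continuous_intros)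
  next
    case (Suc k)
    show ?case
    proof (rule Ck_on_SucI[where f' = "\<lambda>t v. v *\<^sub>R frechet_derivative f (at (A + t *\<^sub>R B)) B"])
      fix t :: real
      note d = Ck_on_Suc_derivative[OF Suc.prems assms(2), of t]
      have "((\<lambda>t. A + t *\<^sub>R B) has_derivative (\<lambda>x. x *\<^sub>R B)) (at t)"
        by (auto intro!: derivative_eq_intros)
      from has_derivative_compose[OF this d]
      show "((\<lambda>t. f (A + t *\<^sub>R B)) has_derivative
          (\<lambda>v. v *\<^sub>R frechet_derivative f (at (A + t *\<^sub>R B)) B)) (at t)"
        by (simp add: linear_cmul[OF has_derivative_linear[OF d]])
    next
      fix v :: real
      have "Ck_on k UNIV (\<lambda>t::real. frechet_derivative f (at (A + t *\<^sub>R B)) B)"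
        using Suc.prems by (intro Suc.IH[of "\<lambda>x. frechet_derivative f (at x) B"]) simp
      then show "Ck_on k UNIV (\<lambda>t::real. v *\<^sub>R frechet_derivative f (at (A + t *\<^sub>R B)) B)"
        by (intro Ck_on_bilinear[OF bounded_bilinear_scaleR] Ck_on_const open_UNIV)
    qed simp
  qed
  then show ?thesis using assms(1) by (simp add: Cinf_on_def)
qed

lemma Cinf_on_reflect: "Cinf_on UNIV f \<Longrightarrow> Cinf_on UNIV (\<lambda>t::real. f (- t))"
  using Cinf_on_affine[of UNIV f 0 "-1"] by simp

lemma Cinf_on_real_derivative:
  fixes f :: "real \<Rightarrow> 'b::real_normed_vector"
  assumes "Cinf_on UNIV f"
  obtains f' where "Cinf_on UNIV f'" "\<And>t. (f has_vector_derivative f' t) (at t)"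
proof
  have f: "Ck_on (Suc k) UNIV f" for k using assms unfolding Cinf_on_def by blast
  then show "Cinf_on UNIV (\<lambda>t. frechet_derivative f (at t) 1)" by (simp add: Cinf_on_def)
  fix t
  note d = Ck_on_Suc_derivative[OF f[of 0] UNIV_I, of t]
  have eq: "frechet_derivative f (at t) = (\<lambda>x. x *\<^sub>R frechet_derivative f (at t) 1)"
  proof
    fix x :: real
    show "frechet_derivative f (at t) x = x *\<^sub>R frechet_derivative f (at t) 1"
      using linear_cmul[OF has_derivative_linear[OF d], of x 1] by (simp only: real_scaleR_def mult_1_right)
  qed
  show "(f has_vector_derivative frechet_derivative f (at t) 1) (at t)"
    unfolding has_vector_derivative_def by (subst eq[symmetric]) (rule d)
qed

lemma Cinf_on_continuous: "Cinf_on S f \<Longrightarrow> continuous_on S f"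
  unfolding Cinf_on_def using Ck_on.simps(1) by blast

text \<open>
  The powers \<open>x\<^sup>j\<close> make the statement closed under differentiation with respect to \<open>t\<close>, each derivative
  producing one more factor \<open>x\<close>. The case \<open>j = 0\<close> is what Hadamard's lemma below uses.
\<close>

lemma Cinf_on_moment_integral:
  fixes f :: "real \<Rightarrow> 'b::banach"
  assumes "Cinf_on UNIV f"
  shows "Cinf_on UNIV (\<lambda>t. integral {0..1} (\<lambda>x. x ^ j *\<^sub>R f (t * x)))"
proof -
  have "Ck_on k UNIV (\<lambda>t. integral {0..1} (\<lambda>x. x ^ j *\<^sub>R f (t * x)))" for k
    using assms
  proof (induction k arbitrary: f j)
    case 0
    have "continuous_on (UNIV \<times> cbox 0 1) (\<lambda>(t, x). x ^ j *\<^sub>R f (t * x))"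
      by (auto simp: split_def intro!: continuous_intros continuous_on_compose2[OF Cinf_on_continuous[OF 0]])
    from integral_continuous_on_param[OF this] show ?case by simp
  next
    case (Suc k)
    obtain f' where f': "Cinf_on UNIV f'" "\<And>t. (f has_vector_derivative f' t) (at t)"
      using Cinf_on_real_derivative[OF Suc.prems] by blast
    let ?I = "\<lambda>t. integral {0..1} (\<lambda>x. x ^ Suc j *\<^sub>R f' (t * x))"
    have c': "continuous_on (UNIV \<times> cbox 0 1) (\<lambda>(t, x). x ^ Suc j *\<^sub>R f' (t * x))"
      by (auto simp: split_def intro!: continuous_intros continuous_on_compose2[OF Cinf_on_continuous[OF f'(1)]])
    have "((\<lambda>t. integral (cbox 0 1) (\<lambda>x. x ^ j *\<^sub>R f (t * x))) has_vector_derivative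
        integral (cbox 0 1) (\<lambda>x. x ^ Suc j *\<^sub>R f' (t * x))) (at t within UNIV)" for t
    proof (rule leibniz_rule_vector_derivative)
      show "((\<lambda>t. x ^ j *\<^sub>R f (t * x)) has_vector_derivative x ^ Suc j *\<^sub>R f' (t * x)) (at t within UNIV)"
        for t x :: real
      proof -
        have "((\<lambda>t. t * x) has_vector_derivative x) (at t)"
          by (auto intro!: derivative_eq_intros simp: has_vector_derivative_def)
        from vector_diff_chain_at[OF this f'(2)]
        have "((\<lambda>t. f (t * x)) has_vector_derivative x *\<^sub>R f' (t * x)) (at t)"
          by (simp add: comp_def)
        from bounded_linear.has_vector_derivative[OF bounded_linear_scaleR_right this, of "x ^ j"]
        show ?thesis by (simp add: mult.commute)
      qed
      show "(\<lambda>x. x ^ j *\<^sub>R f (t * x)) integrable_on cbox 0 1" for t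
        by (intro integrable_continuous continuous_intros continuous_on_compose2[OF Cinf_on_continuous[OF Suc.prems]]) auto
    qed (use c' in auto)
    then have d: "((\<lambda>t. integral {0..1} (\<lambda>x. x ^ j *\<^sub>R f (t * x))) has_derivative (\<lambda>v. v *\<^sub>R ?I t)) (at t)" for t
      by (simp add: has_vector_derivative_def)
    show ?case
      by (rule Ck_on_SucI[OF open_UNIV d])
        (intro Ck_on_bilinear[OF bounded_bilinear_scaleR] Ck_on_const open_UNIV Suc.IH f'(1))
  qed
  then show ?thesis by (simp add: Cinf_on_def)
qed

text \<open>
  Hadamard's lemma: \<open>f t = t \<integral> f' (t x) dx\<close> with \<open>x\<close> ranging over \<open>[0,1]\<close>.
\<close>

lemma Cinf_on_divide_at_0:
  fixes f :: "real \<Rightarrow> 'b::banach"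
  assumes f: "Cinf_on UNIV f" and "f 0 = 0"
  obtains g where "Cinf_on UNIV g" "\<And>t. f t = t *\<^sub>R g t"
proof -
  obtain f' where f': "Cinf_on UNIV f'" "\<And>t. (f has_vector_derivative f' t) (at t)"
    using Cinf_on_real_derivative[OF f] by blast
  define g where "g t = integral {0..1} (\<lambda>x. f' (t * x))" for t
  have "Cinf_on UNIV g" using Cinf_on_moment_integral[OF f'(1), of 0] by (simp add: g_def[abs_def])
  moreover have "f t = t *\<^sub>R g t" for t
  proof -
    have "((\<lambda>x. t *\<^sub>R f' (t * x)) has_integral (f (t * 1) - f (t * 0))) {0..1}"
    proof (rule fundamental_theorem_of_calculus)
      fix x :: real
      have "((\<lambda>x. t * x) has_vector_derivative t) (at x)"
        by (auto intro!: derivative_eq_intros simp: has_vector_derivative_def)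
      from vector_diff_chain_at[OF this f'(2)]
      show "((\<lambda>x. f (t * x)) has_vector_derivative t *\<^sub>R f' (t * x)) (at x within {0..1})"
        by (simp add: comp_def has_vector_derivative_at_within)
    qed simp
    from integral_unique[OF this] show ?thesis by (simp add: g_def assms(2))
  qed
  ultimately show thesis using that by blast
qed

definition even_Cinf :: "(real \<Rightarrow> 'b::real_normed_vector) \<Rightarrow> bool" where
  "even_Cinf f \<longleftrightarrow> Cinf_on UNIV f \<and> (\<forall>t. f (- t) = f t)"

lemma even_Cinf_mult:
  fixes f g :: "real \<Rightarrow> 'b::real_normed_algebra"
  shows "even_Cinf f \<Longrightarrow> even_Cinf g \<Longrightarrow> even_Cinf (\<lambda>t. f t * g t)"
  by (simp add: even_Cinf_def Cinf_on_mult)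

lemma even_Cinf_continuous: "even_Cinf f \<Longrightarrow> continuous_on A f"
  by (auto simp: even_Cinf_def intro: continuous_on_subset[OF Cinf_on_continuous])

lemma odd_quotient_even_Cinf:
  fixes f :: "real \<Rightarrow> 'b::banach"
  assumes "Cinf_on UNIV f" "\<And>t. f (- t) = - f t"
  obtains g where "even_Cinf g" "\<And>t. f t = t *\<^sub>R g t"
proof -
  have "f 0 + f 0 = 0" using assms(2)[of 0] by (simp add: eq_neg_iff_add_eq_0)
  then have "f 0 = 0" by (simp flip: scaleR_2)
  then obtain g where g: "Cinf_on UNIV g" "\<And>t. f t = t *\<^sub>R g t"
    using Cinf_on_divide_at_0[OF assms(1)] by blast
  have "g (- t) = g t" for t
  proof (cases "t = 0")
    case False
    have "t *\<^sub>R g (- t) = - f (- t)" by (simp add: g(2)[of "- t"])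
    also have "\<dots> = t *\<^sub>R g t" using assms(2)[of t] g(2)[of t] by simp
    finally show ?thesis using False by (metis scaleR_cancel_left)
  qed simp
  then show thesis using that g by (auto simp: even_Cinf_def)
qed

text \<open>
  The operator \<open>f \<mapsto> f'(t)/t\<close>. It preserves even smooth functions, and in it integration by parts raises the
  exponent of a Mellin integral by \<open>2\<close>, skipping the exponents at which an even function has no pole.
\<close>

definition radial_deriv :: "(real \<Rightarrow> 'b::banach) \<Rightarrow> real \<Rightarrow> 'b" where
  "radial_deriv f = (SOME g. even_Cinf g \<and> (\<forall>t. (f has_vector_derivative t *\<^sub>R g t) (at t)))"

lemma radial_deriv:
  fixes f :: "real \<Rightarrow> 'b::banach"
  assumes "even_Cinf f"
  shows "even_Cinf (radial_deriv f)" "(f has_vector_derivative t *\<^sub>R radial_deriv f t) (at t)"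
proof -
  obtain f' where f': "Cinf_on UNIV f'" "\<And>t. (f has_vector_derivative f' t) (at t)"
    using Cinf_on_real_derivative assms even_Cinf_def by blast
  have "f' (- t) = - f' t" for t
  proof -
    have "(uminus has_vector_derivative -1) (at t)"
      by (auto intro!: derivative_eq_intros simp: has_vector_derivative_def)
    from vector_diff_chain_at[OF this f'(2)]
    have "((\<lambda>t. f (- t)) has_vector_derivative - f' (- t)) (at t)" by (simp add: comp_def)
    then have "(f has_vector_derivative - f' (- t)) (at t)" using assms by (simp add: even_Cinf_def)
    from vector_derivative_unique_at[OF this f'(2)] show ?thesis by (metis minus_minus)
  qed
  then obtain g where "even_Cinf g" "\<And>t. f' t = t *\<^sub>R g t"
    using odd_quotient_even_Cinf[OF f'(1)] by blast
  then have "\<exists>g. even_Cinf g \<and> (\<forall>t. (f has_vector_derivative t *\<^sub>R g t) (at t))"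
    using f'(2) by auto
  from someI_ex[OF this]
  show "even_Cinf (radial_deriv f)" "(f has_vector_derivative t *\<^sub>R radial_deriv f t) (at t)"
    unfolding radial_deriv_def by blast+
qed

text \<open>
  Against the sign character of \<open>a\<close> only the even or the odd part of \<open>f\<close> survives. Dividing the odd part by \<open>t\<close> makes both
  cases even, at the price of the shift of the exponent by \<open>[a]\<close> that appears in the Gamma factors.
\<close>

lemma parity_part:
  fixes f :: "real \<Rightarrow> complex"
  assumes "Cinf_on UNIV f"
  obtains g where "even_Cinf g" "\<And>t. f t + (- 1) ^ rep a * f (- t) = of_real t ^ rep a * g t"
proof -
  let ?h = "\<lambda>t. f t + (- 1) ^ rep a * f (- t)"
  have h: "Cinf_on UNIV ?h"
    by (rule Cinf_on_add[OF open_UNIV assms Cinf_on_mult[OF open_UNIV _ Cinf_on_reflect[OF assms]]])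
      (simp add: Cinf_on_def Ck_on_const)
  show thesis
  proof (cases "a = 1")
    case True
    then have "?h (- t) = - ?h t" for t by (simp add: rep_def)
    then obtain g where "even_Cinf g" "\<And>t. ?h t = t *\<^sub>R g t"
      using odd_quotient_even_Cinf[OF h] by blast
    then show thesis using that True by (simp add: rep_def scaleR_conv_of_real)
  next
    case False
    then show thesis using that[of ?h] h by (simp add: rep_def even_Cinf_def add.commute)
  qed
qed

section \<open>Analytic continuation of a Mellin integral\<close>

lemma continuous_on_x_ln_x: "continuous_on {0..1} (\<lambda>t::real. t * ln t)"
proof -
  have "continuous (at t within {0..1}) (\<lambda>t. t * ln t)" if "t \<in> {0..1}" for t :: real
  proof (cases "t = 0")
    case True
    have "((\<lambda>t::real. t * ln t) \<longlongrightarrow> 0) (at_right 0)" by real_asymp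
    then show ?thesis unfolding True continuous_within
      by (simp add: at_within_Icc_at_right)
  next
    case False
    then have "isCont (\<lambda>t. t * ln t) t" by (auto intro!: continuous_intros)
    then show ?thesis by (rule continuous_at_imp_continuous_within)
  qed
  then show ?thesis by (simp add: continuous_on_eq_continuous_within)
qed

lemma continuous_on_rGamma_compose [continuous_intros]:
  "continuous_on A f \<Longrightarrow> continuous_on A (\<lambda>x. rGamma (f x :: complex))"
  by (rule continuous_on_compose2[OF continuous_on_rGamma[of UNIV]]) auto

text \<open>
  Holomorphy along all complex lines, with joint continuity, rather than in each variable separately: in the application the
  parameter \<open>m\<^sub>1\<close> occurs in both arguments, and restricting to lines keeps such substitutions within reach of the theory of
  one complex variable.
\<close>

definition line_holomorphic :: "real \<Rightarrow> (complex \<Rightarrow> complex \<Rightarrow> complex) \<Rightarrow> bool" where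
  "line_holomorphic r N \<longleftrightarrow> continuous_on {x. Re (fst x) > r} (\<lambda>x. N (fst x) (snd x)) \<and>
     (\<forall>a b c d. (\<lambda>z. N (a + z * b) (c + z * d)) holomorphic_on {z. Re (a + z * b) > r})"

text \<open>
  The weight \<open>q\<close> stands for the Gram determinant along a chart of the line of integration, and its exponent \<open>w\<close> carries
  the dependence on the inducing parameters.
\<close>

locale even_weight =
  fixes q :: "real \<Rightarrow> real"
  assumes q_even: "even_Cinf q" and q_pos: "\<And>t. q t > 0"
begin

definition mellin :: "(real \<Rightarrow> complex) \<Rightarrow> complex \<Rightarrow> complex \<Rightarrow> complex" where
  "mellin f s w = integral {0..1} (\<lambda>t. of_real t powr (s - 1) * f t * of_real (q t) powr w)"

lemma q_continuous: "continuous_on A q"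
  by (rule even_Cinf_continuous[OF q_even])

lemma continuous_on_q_powr [continuous_intros]:
  assumes "continuous_on A f" "continuous_on A g"
  shows "continuous_on A (\<lambda>x. complex_of_real (q (f x)) powr g x)"
  using q_pos assms
  by (intro continuous_on_powr_complex continuous_on_of_real continuous_on_compose2[OF q_continuous[of UNIV]])
    (auto simp: less_imp_le less_imp_neq[symmetric])

lemma continuous_on_mellin_integrand:
  assumes "continuous_on UNIV f" "continuous_on S g" "continuous_on S h"
    "\<And>x. x \<in> S \<Longrightarrow> Re (g x) > 0"
  shows "continuous_on (S \<times> cbox 0 1) (\<lambda>(x, t). of_real t powr g x * f t * of_real (q t) powr h x)"
  using assms(4) unfolding split_def
  by (intro continuous_intros continuous_on_compose2[OF assms(1)] continuous_on_compose2[OF assms(2)]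
      continuous_on_compose2[OF assms(3)]) auto

text \<open>
  The integral converges for \<open>Re s > 0\<close>, but for \<open>Re s > 2\<close> the integrand and its derivative along a line extend continuously to
  \<open>t = 0\<close>, so that differentiation under the integral over the compact interval applies. The rest of the half
  plane is recovered by \<open>mellin_by_parts\<close>.
\<close>

lemma mellin_line_holomorphic:
  assumes f: "continuous_on UNIV f"
  shows "line_holomorphic 2 (mellin f)"
  unfolding line_holomorphic_def
proof (intro conjI allI)
  let ?S = "{x::complex \<times> complex. Re (fst x) > 2}"
  have "continuous_on (?S \<times> cbox 0 1)
      (\<lambda>(x, t). of_real t powr (fst x - 1) * f t * of_real (q t) powr snd x)"
    by (rule continuous_on_mellin_integrand[OF f]) (auto intro!: continuous_intros)
  from integral_continuous_on_param[OF this]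
  show "continuous_on ?S (\<lambda>x. mellin f (fst x) (snd x))" by (simp add: mellin_def)
next
  fix a b c d :: complex
  let ?U = "{z. Re (a + z * b) > 2}"
  let ?g = "\<lambda>z t. of_real t powr (a + z * b - 1) * f t * of_real (q t) powr (c + z * d)"
  let ?g' = "\<lambda>z t. ?g z t * (b * of_real (ln t) + d * of_real (ln (q t)))"
  have "(\<lambda>z. integral (cbox 0 1) (?g z)) holomorphic_on ?U"
  proof (rule leibniz_rule_holomorphic)
    fix z and t :: real assume z: "z \<in> ?U" and t: "t \<in> cbox 0 1"
    show "((\<lambda>z. ?g z t) has_field_derivative ?g' z t) (at z within ?U)"
    proof (cases "t = 0")
      case False
      with t have "t > 0" by simp
      then show ?thesis using q_pos[of t]
        by (auto intro!: derivative_eq_intros simp: Ln_of_real algebra_simps powr_def)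
    qed simp
  next
    fix z assume "z \<in> ?U"
    then have "Re (a + z * b - 1) > 0" by simp
    then have "continuous_on (cbox 0 1) (?g z)"
      by (intro continuous_intros continuous_on_subset[OF f]) auto
    then show "?g z integrable_on cbox 0 1" by (rule integrable_continuous)
  next
    \<comment> \<open>One of the spare powers of \<open>t\<close> absorbs the singularity of \<open>ln t\<close> at \<open>0\<close>; at \<open>t = 0\<close> both
      sides vanish because \<open>0 powr _ = 0\<close>.\<close>
    have eq: "?g' z t = of_real t powr (a + z * b - 2) * f t * of_real (q t) powr (c + z * d)
        * (b * of_real (t * ln t) + d * of_real (t * ln (q t)))" if "t \<in> cbox 0 1" for z t
    proof (cases "t = 0")
      case False
      with that have "t > 0" by simp
      then have "complex_of_real t powr (a + z * b - 1) = of_real t powr (a + z * b - 2) * of_real t"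
        using powr_add[of "of_real t" "a + z * b - 2" 1] by simp
      then show ?thesis by (simp add: algebra_simps)
    qed simp
    have "continuous_on (?U \<times> cbox 0 1) (\<lambda>(z, t). of_real t powr (a + z * b - 2) * f t * of_real (q t) powr (c + z * d))"
      by (rule continuous_on_mellin_integrand[OF f]) (auto intro!: continuous_intros)
    moreover have "continuous_on (?U \<times> cbox 0 1) (\<lambda>(z, t). b * of_real (t * ln t) + d * of_real (t * ln (q t)))"
      unfolding split_def using q_pos
      by (intro continuous_intros continuous_on_compose2[OF continuous_on_x_ln_x] continuous_on_compose2[OF q_continuous[of UNIV]])
        (auto simp: less_imp_neq[symmetric])
    ultimately have "continuous_on (?U \<times> cbox 0 1) (\<lambda>x. (case x of (z, t) \<Rightarrow> of_real t powr (a + z * b - 2) * f t * of_real (q t) powr (c + z * d))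
       * (case x of (z, t) \<Rightarrow> b * of_real (t * ln t) + d * of_real (t * ln (q t))))"
      by (rule continuous_on_mult)
    then show "continuous_on (?U \<times> cbox 0 1) (\<lambda>(z, t). ?g' z t)"
      by (rule continuous_on_eq) (auto simp: eq simp del: of_real_mult)
  next
    show "convex ?U"
    proof -
      have eq: "?U = (\<lambda>z. z * b) -` {z. Re z > 2 - Re a}" by auto
      have lin: "linear (\<lambda>z. z * b)" by (rule linearI) (auto simp: algebra_simps)
      show ?thesis unfolding eq by (rule convex_linear_vimage[OF lin convex_halfspace_Re_gt])
    qed
  qed
  then show "(\<lambda>z. mellin f (a + z * b) (c + z * d)) holomorphic_on ?U" by (simp add: mellin_def)
qed

text \<open>
  Integrate the derivative of \<open>t\<^sup>s f(t) q(t)\<^sup>w\<close> over \<open>[0,1]\<close>. Since \<open>f'\<close> and \<open>q'\<close> are divisible by \<open>t\<close>, the remaining integrals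
  have exponent \<open>s + 2\<close>; the derivative of the weight lowers \<open>w\<close> by \<open>1\<close>, so the family of all these integrals is closed
  under the operation.
\<close>

lemma mellin_by_parts:
  assumes f: "even_Cinf f" and s: "Re s > 0"
  shows "s * mellin f s w = f 1 * of_real (q 1) powr w - mellin (radial_deriv f) (s + 2) w
      - w * mellin (\<lambda>t. f t * of_real (radial_deriv q t)) (s + 2) (w - 1)"
proof -
  let ?F = "\<lambda>t. of_real t powr s * f t * of_real (q t) powr w"
  let ?A = "\<lambda>t. of_real t powr (s - 1) * f t * of_real (q t) powr w"
  let ?B = "\<lambda>t. of_real t powr (s + 2 - 1) * radial_deriv f t * of_real (q t) powr w"
  let ?C = "\<lambda>t. of_real t powr (s + 2 - 1) * (f t * of_real (radial_deriv q t)) * of_real (q t) powr (w - 1)"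
  note rf = radial_deriv[OF f] and rq = radial_deriv[OF q_even]
  have cont: "continuous_on {0..1} (\<lambda>t. of_real t powr z * g t * of_real (q t) powr v)"
    if "Re z > 0" "continuous_on UNIV g" for z v g
    using that(1) by (intro continuous_intros continuous_on_subset[OF that(2)]) auto
  have "((\<lambda>t. s * ?A t + ?B t + w * ?C t) has_integral (?F 1 - ?F 0)) {0..1}"
  proof (rule fundamental_theorem_of_calculus_interior)
    show "continuous_on {0..1} ?F"
      using s by (intro cont even_Cinf_continuous[OF f]) auto
    fix t :: real assume "t \<in> {0<..<1}"
    then have t: "t > 0" by simp
    have 1: "((\<lambda>t. complex_of_real t powr s) has_vector_derivative s * of_real t powr (s - 1)) (at t)"
    proof -
      have "((\<lambda>z. z powr s) has_field_derivative s * of_real t powr (s - 1)) (at (complex_of_real t))"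
        using t by (intro has_field_derivative_powr) (simp add: complex_nonpos_Reals_iff)
      from field_vector_diff_chain_at[OF has_vector_derivative_of_real[OF DERIV_ident] this]
      show ?thesis by (simp add: comp_def)
    qed
    have 3: "((\<lambda>t. complex_of_real (q t) powr w) has_vector_derivative
        of_real (t * radial_deriv q t) * (w * of_real (q t) powr (w - 1))) (at t)"
    proof -
      have d: "((\<lambda>z. z powr w) has_field_derivative w * of_real (q t) powr (w - 1)) (at (complex_of_real (q t)))"
        using q_pos[of t] by (intro has_field_derivative_powr) (simp add: complex_nonpos_Reals_iff)
      have "(q has_real_derivative t * radial_deriv q t) (at t)"
        using rq(2)[of t] by (simp add: has_real_derivative_iff_has_vector_derivative)
      from field_vector_diff_chain_at[OF has_vector_derivative_of_real[OF this] d]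
      show ?thesis by (simp add: comp_def)
    qed
    have e: "complex_of_real t powr (1 + s) = of_real t powr s * of_real t"
      using t by (simp add: powr_add)
    show "(?F has_vector_derivative s * ?A t + ?B t + w * ?C t) (at t)"
      by (rule has_vector_derivative_eq_rhs[OF has_vector_derivative_mult[OF has_vector_derivative_mult[OF 1 rf(2)] 3]])
        (simp add: e scaleR_conv_of_real algebra_simps)
  qed simp
  moreover have "(?B has_integral mellin (radial_deriv f) (s + 2) w) {0..1}"
    unfolding mellin_def using s even_Cinf_continuous[OF rf(1)]
    by (intro integrable_integral integrable_continuous_real cont) auto
  moreover have "(?C has_integral mellin (\<lambda>t. f t * of_real (radial_deriv q t)) (s + 2) (w - 1)) {0..1}"
    unfolding mellin_def using s even_Cinf_continuous[OF rq(1)] even_Cinf_continuous[OF f]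
    by (intro integrable_integral integrable_continuous_real cont continuous_intros) auto
  ultimately have "((\<lambda>t. (s * ?A t + ?B t + w * ?C t) - ?B t - w * ?C t) has_integral
     (?F 1 - ?F 0) - mellin (radial_deriv f) (s + 2) w
      - w * mellin (\<lambda>t. f t * of_real (radial_deriv q t)) (s + 2) (w - 1)) {0..1}"
    by (intro has_integral_diff has_integral_mult_right)
  then have "integral {0..1} (\<lambda>t. s * ?A t) = (?F 1 - ?F 0) - mellin (radial_deriv f) (s + 2) w
      - w * mellin (\<lambda>t. f t * of_real (radial_deriv q t)) (s + 2) (w - 1)"
    by (intro integral_unique) simp
  moreover have "integral {0..1} (\<lambda>t. s * ?A t) = s * mellin f s w"
    unfolding mellin_def by (rule integral_mult_right)
  ultimately show ?thesis by simp
qed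

text \<open>
  The \<open>k\<close>-fold iterate of \<open>mellin_by_parts\<close> for the integral normalized by \<open>\<Gamma>(s/2)\<inverse>\<close>. The functional equation
  \<open>\<Gamma>(s/2)\<inverse> = (s/2) \<Gamma>(s/2 + 1)\<inverse>\<close> cancels the division by \<open>s\<close>, which is why no pole appears.
\<close>

fun mellin_step :: "nat \<Rightarrow> (real \<Rightarrow> complex) \<Rightarrow> complex \<Rightarrow> complex \<Rightarrow> complex" where
  "mellin_step 0 f s w = rGamma (s / 2) * mellin f s w"
| "mellin_step (Suc k) f s w = (rGamma (s / 2 + 1) * f 1 * of_real (q 1) powr w
     - mellin_step k (radial_deriv f) (s + 2) w
     - w * mellin_step k (\<lambda>t. f t * of_real (radial_deriv q t)) (s + 2) (w - 1)) / 2"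

lemma even_Cinf_mult_radial_deriv:
  assumes "even_Cinf f" shows "even_Cinf (\<lambda>t. f t * complex_of_real (radial_deriv q t))"
  using radial_deriv(1)[OF q_even] by (intro even_Cinf_mult assms) (auto simp: even_Cinf_def intro: Cinf_on_of_real)

text \<open>
  Further steps do not change the value where the earlier ones already continue the integral. The case \<open>k = 0\<close> is
  integration by parts; the general case is the same identity at \<open>s + 2\<close> in both recursive calls.
\<close>

lemma mellin_step_Suc:
  "even_Cinf f \<Longrightarrow> Re s > - 2 * real k \<Longrightarrow> mellin_step (Suc k) f s w = mellin_step k f s w"
proof (induction k arbitrary: f s w)
  case 0
  have "rGamma (s / 2) * mellin f s w = rGamma (s / 2 + 1) * (s * mellin f s w) / 2"
    by (subst rGamma_plus1[symmetric]) simp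
  also have "\<dots> = mellin_step (Suc 0) f s w"
    using 0 by (subst mellin_by_parts) (auto simp: algebra_simps add_divide_distrib)
  finally show ?case by simp
next
  case (Suc k)
  have "mellin_step (Suc k) g (s + 2) v = mellin_step k g (s + 2) v" if "even_Cinf g" for g v
    using Suc.prems by (intro Suc.IH that) auto
  note eqs = this[OF radial_deriv(1)[OF Suc.prems(1)]] this[OF even_Cinf_mult_radial_deriv[OF Suc.prems(1)]]
  show ?case
    unfolding mellin_step.simps(2)[of "Suc k" f] mellin_step.simps(2)[of k f] eqs ..
qed

lemma mellin_step_line_holomorphic:
  "even_Cinf f \<Longrightarrow> line_holomorphic (2 - 2 * real k) (mellin_step k f)"
proof (induction k arbitrary: f)
  case 0
  have "line_holomorphic 2 (mellin f)" using 0 by (intro mellin_line_holomorphic even_Cinf_continuous)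
  then show ?case unfolding line_holomorphic_def
    by (auto intro!: continuous_intros holomorphic_intros)
next
  case (Suc k)
  let ?g = "\<lambda>t. f t * complex_of_real (radial_deriv q t)"
  let ?r = "2 - 2 * real (Suc k)"
  have shift: "line_holomorphic ?r (\<lambda>s w. mellin_step k g (s + 2) (w + v))" if "even_Cinf g" for g v
    unfolding line_holomorphic_def
  proof (intro conjI allI)
    have "continuous_on {x. Re (fst x) > 2 - 2 * real k} (\<lambda>x. mellin_step k g (fst x) (snd x))"
      using Suc.IH[OF that] by (simp add: line_holomorphic_def)
    then have "continuous_on {x. Re (fst x) > ?r}
        (\<lambda>x. mellin_step k g (fst (fst x + 2, snd x + v)) (snd (fst x + 2, snd x + v)))"
      by (rule continuous_on_compose2) (auto intro!: continuous_intros)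
    then show "continuous_on {x. Re (fst x) > ?r} (\<lambda>x. mellin_step k g (fst x + 2) (snd x + v))"
      by simp
    fix a b c d
    have "(\<lambda>z. mellin_step k g ((a + 2) + z * b) ((c + v) + z * d)) holomorphic_on
        {z. Re ((a + 2) + z * b) > 2 - 2 * real k}"
      using Suc.IH[OF that] unfolding line_holomorphic_def by blast
    moreover have "{z. Re ((a + 2) + z * b) > 2 - 2 * real k} = {z. Re (a + z * b) > ?r}" by auto
    ultimately show "(\<lambda>z. mellin_step k g (a + z * b + 2) (c + z * d + v)) holomorphic_on {z. Re (a + z * b) > ?r}"
      by (simp add: algebra_simps)
  qed
  note A = shift[OF radial_deriv(1)[OF Suc.prems], of 0, simplified add_0_right]
    and B = shift[OF even_Cinf_mult_radial_deriv[OF Suc.prems], of "-1", folded diff_conv_add_uminus]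
  show ?case
    unfolding line_holomorphic_def mellin_step.simps(2)
  proof (intro conjI allI)
    show "continuous_on {x. Re (fst x) > ?r} (\<lambda>x. (rGamma (fst x / 2 + 1) * f 1 * of_real (q 1) powr snd x
       - mellin_step k (radial_deriv f) (fst x + 2) (snd x) - snd x * mellin_step k ?g (fst x + 2) (snd x - 1)) / 2)"
      using A B unfolding line_holomorphic_def by (intro continuous_intros) auto
    fix a b c d
    show "(\<lambda>z. (rGamma ((a + z * b) / 2 + 1) * f 1 * of_real (q 1) powr (c + z * d)
       - mellin_step k (radial_deriv f) (a + z * b + 2) (c + z * d)
       - (c + z * d) * mellin_step k ?g (a + z * b + 2) (c + z * d - 1)) / 2) holomorphic_on {z. Re (a + z * b) > ?r}"
      using A B q_pos[of 1] unfolding line_holomorphic_def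
      by (intro holomorphic_intros) auto
  qed
qed

text \<open>
  The number of steps only has to exceed \<open>- Re s / 2\<close>, beyond which it does not influence the value.
\<close>

definition mellin_cont :: "(real \<Rightarrow> complex) \<Rightarrow> complex \<Rightarrow> complex \<Rightarrow> complex" where
  "mellin_cont f s w = mellin_step (nat \<lceil>- Re s\<rceil> + 1) f s w"

lemma mellin_cont_eq_step:
  assumes "even_Cinf f" "Re s > - 2 * real k"
  shows "mellin_cont f s w = mellin_step k f s w"
proof -
  have le: "mellin_step m f s w = mellin_step k f s w" if "Re s > - 2 * real k" "k \<le> m" for k m
    using that(2)
  proof (induction m rule: dec_induct)
    case (step m)
    then have "Re s > - 2 * real m" using that(1) by simp
    then show ?case using mellin_step_Suc[OF assms(1)] step.IH by simp
  qed simp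
  let ?m = "nat \<lceil>- Re s\<rceil> + 1"
  have "Re s > - 2 * real ?m" using real_nat_ceiling_ge[of "- Re s"] by simp
  then show ?thesis unfolding mellin_cont_def using le[of ?m "max ?m k"] le[of k "max ?m k"] assms(2) by simp
qed

lemma mellin_cont_eq:
  assumes "even_Cinf f" "Re s > 0" shows "mellin_cont f s w = rGamma (s / 2) * mellin f s w"
  using mellin_cont_eq_step[OF assms(1), of 0] assms(2) by simp

lemma open_Re_gt: "open {z. Re (a + z * b) > r}"
  by (intro open_Collect_less continuous_intros)

lemma mellin_cont_continuous:
  assumes "even_Cinf f" "continuous_on A g" "continuous_on A h"
  shows "continuous_on A (\<lambda>x. mellin_cont f (g x) (h x))"
proof -
  let ?S = "\<lambda>k. {x::complex \<times> complex. Re (fst x) > 2 - 2 * real k}"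
  have "continuous_on (\<Union>k. ?S k) (\<lambda>x. mellin_cont f (fst x) (snd x))"
  proof (rule continuous_on_open_UN)
    fix k
    have "continuous_on (?S k) (\<lambda>x. mellin_step k f (fst x) (snd x))"
      using mellin_step_line_holomorphic[OF assms(1), of k] by (simp add: line_holomorphic_def)
    then show "continuous_on (?S k) (\<lambda>x. mellin_cont f (fst x) (snd x))"
      by (rule continuous_on_eq) (auto intro!: mellin_cont_eq_step[OF assms(1), symmetric])
    show "open (?S k)" by (intro open_Collect_less continuous_intros)
  qed
  moreover have "(\<Union>k. ?S k) = UNIV"
  proof -
    have "\<exists>k. 2 - 2 * real k < r" for r
      using reals_Archimedean2[of "(2 - r) / 2"] by (auto simp: field_simps)
    then show ?thesis by auto
  qed
  ultimately have "continuous_on UNIV (\<lambda>x. mellin_cont f (fst x) (snd x))" by simp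
  from continuous_on_compose2[OF this, of A "\<lambda>x. (g x, h x)"] assms(2,3)
  show ?thesis by (auto intro!: continuous_intros)
qed

lemma mellin_cont_holomorphic_line:
  assumes "even_Cinf f"
  shows "(\<lambda>z. mellin_cont f (a + z * b) (c + z * d)) holomorphic_on UNIV"
proof -
  let ?S = "\<lambda>k. {z. Re (a + z * b) > 2 - 2 * real k}"
  have "(\<lambda>z. mellin_cont f (a + z * b) (c + z * d)) holomorphic_on (\<Union>k. ?S k)"
  proof (rule holomorphic_on_UN_open)
    fix k
    have "(\<lambda>z. mellin_step k f (a + z * b) (c + z * d)) holomorphic_on ?S k"
      using mellin_step_line_holomorphic[OF assms(1), of k] by (simp only: line_holomorphic_def)
    then show "(\<lambda>z. mellin_cont f (a + z * b) (c + z * d)) holomorphic_on ?S k"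
      by (rule holomorphic_transform) (auto intro!: mellin_cont_eq_step[OF assms(1), symmetric])
    show "open (?S k)" by (rule open_Re_gt)
  qed
  moreover have "(\<Union>k. ?S k) = UNIV"
  proof -
    have "\<exists>k. 2 - 2 * real k < r" for r
      using reals_Archimedean2[of "(2 - r) / 2"] by (auto simp: field_simps)
    then show ?thesis by auto
  qed
  ultimately show ?thesis by simp
qed

lemma mellin_cont_holomorphic_affine:
  assumes "even_Cinf f" "\<And>z. g z = a + z * b" "\<And>z. h z = c + z * d"
  shows "(\<lambda>z. mellin_cont f (g z) (h z)) holomorphic_on UNIV"
  unfolding assms(2,3) by (rule mellin_cont_holomorphic_line[OF assms(1)])

end

section \<open>Folding the integral over the line\<close>

text \<open>
  The four pieces are the images of \<open>(0,1)\<close> under \<open>u \<mapsto> u\<close>, \<open>-u\<close>, \<open>1/u\<close> and \<open>-1/u\<close>; they exhaust \<open>\<real> - {0}\<close> up to the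
  two points \<open>1\<close> and \<open>-1\<close>.
\<close>

lemma integral_inversion_split:
  fixes G :: "real \<Rightarrow> complex"
  assumes "G absolutely_integrable_on {0<..<1}" "(\<lambda>u. G (- u)) absolutely_integrable_on {0<..<1}"
    and "(\<lambda>u. G (1 / u) / u\<^sup>2) absolutely_integrable_on {0<..<1}"
    and "(\<lambda>u. G (- 1 / u) / u\<^sup>2) absolutely_integrable_on {0<..<1}"
  shows "G absolutely_integrable_on - {0}"
    and "integral (- {0}) G = integral {0<..<1} G + integral {0<..<1} (\<lambda>u. G (- u))
      + integral {0<..<1} (\<lambda>u. G (1 / u) / u\<^sup>2) + integral {0<..<1} (\<lambda>u. G (- 1 / u) / u\<^sup>2)"
proof -
  let ?I = "{0<..<1::real}"
  have I: "?I \<in> sets lebesgue" by simp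
  have im2: "uminus ` ?I = {-1<..<0}" by force
  have im3: "(\<lambda>u. 1 / u) ` ?I = {1<..}"
  proof (intro equalityI subsetI)
    fix x :: real assume "x \<in> {1<..}"
    then show "x \<in> (\<lambda>u. 1 / u) ` ?I" by (intro image_eqI[of _ _ "1 / x"]) (auto simp: field_simps)
  qed (auto simp: field_simps)
  have im4: "(\<lambda>u. - 1 / u) ` ?I = {..<-1}"
  proof (intro equalityI subsetI)
    fix x :: real assume "x \<in> {..<-1}"
    then show "x \<in> (\<lambda>u. - 1 / u) ` ?I" by (intro image_eqI[of _ _ "- 1 / x"]) (auto simp: field_simps)
  qed (auto simp: field_simps)
  have "(uminus has_field_derivative -1) (at u within ?I)" for u :: real
    by (auto intro!: derivative_eq_intros)
  then have 2: "G absolutely_integrable_on {-1<..<0}" "integral {-1<..<0} G = integral ?I (\<lambda>u. G (- u))"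
    using has_absolute_integral_change_of_variables_real[OF I, of uminus "\<lambda>_. -1" G "integral ?I (\<lambda>u. G (- u))"]
      assms(2) by (simp_all add: im2)
  have 3: "G absolutely_integrable_on {1<..}" "integral {1<..} G = integral ?I (\<lambda>u. G (1 / u) / u\<^sup>2)"
  proof -
    have "(\<lambda>u. \<bar>- 1 / u\<^sup>2\<bar> *\<^sub>R G (1 / u)) = (\<lambda>u. G (1 / u) / u\<^sup>2)"
      by (auto simp: fun_eq_iff scaleR_conv_of_real)
    moreover have "((\<lambda>u. 1 / u) has_field_derivative - 1 / u\<^sup>2) (at u within ?I)" if "u \<in> ?I" for u :: real
      using that by (auto intro!: derivative_eq_intros simp: power2_eq_square)
    moreover have "inj_on (\<lambda>u. 1 / u) ?I" by (auto simp: inj_on_def)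
    ultimately show "G absolutely_integrable_on {1<..}" "integral {1<..} G = integral ?I (\<lambda>u. G (1 / u) / u\<^sup>2)"
      using has_absolute_integral_change_of_variables_real[OF I, of "\<lambda>u. 1 / u" "\<lambda>u. - 1 / u\<^sup>2" G "integral ?I (\<lambda>u. G (1 / u) / u\<^sup>2)"]
      assms(3) unfolding im3 by auto
  qed
  have 4: "G absolutely_integrable_on {..<-1}" "integral {..<-1} G = integral ?I (\<lambda>u. G (- 1 / u) / u\<^sup>2)"
  proof -
    have "(\<lambda>u. \<bar>1 / u\<^sup>2\<bar> *\<^sub>R G (- 1 / u)) = (\<lambda>u. G (- 1 / u) / u\<^sup>2)"
      by (auto simp: fun_eq_iff scaleR_conv_of_real)
    moreover have "((\<lambda>u. - 1 / u) has_field_derivative 1 / u\<^sup>2) (at u within ?I)" if "u \<in> ?I" for u :: real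
      using that by (auto intro!: derivative_eq_intros simp: power2_eq_square)
    moreover have "inj_on (\<lambda>u. - 1 / u) ?I" by (auto simp: inj_on_def)
    ultimately show "G absolutely_integrable_on {..<-1}" "integral {..<-1} G = integral ?I (\<lambda>u. G (- 1 / u) / u\<^sup>2)"
      using has_absolute_integral_change_of_variables_real[OF I, of "\<lambda>u. - 1 / u" "\<lambda>u. 1 / u\<^sup>2" G "integral ?I (\<lambda>u. G (- 1 / u) / u\<^sup>2)"]
      assms(4) unfolding im4 by auto
  qed
  have hi: "(G has_integral integral S G) S" if "G absolutely_integrable_on S" for S
    using that by (simp add: absolutely_integrable_on_def integrable_integral)
  let ?U = "((?I \<union> {-1<..<0}) \<union> {1<..}) \<union> {..<-1::real}"
  have U: "(G has_integral integral ?I G + integral ?I (\<lambda>u. G (- u))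
      + integral ?I (\<lambda>u. G (1 / u) / u\<^sup>2) + integral ?I (\<lambda>u. G (- 1 / u) / u\<^sup>2)) ?U"
    using hi[OF assms(1)] hi[OF 2(1)] hi[OF 3(1)] hi[OF 4(1)] unfolding 2(2) 3(2) 4(2)
  proof (intro has_integral_Un)
    have "?I \<inter> {-1<..<0} = {}" "(?I \<union> {-1<..<0}) \<inter> {1<..} = {}" "((?I \<union> {-1<..<0}) \<union> {1<..}) \<inter> {..<-1} = {}"
      by auto
    then show "negligible (?I \<inter> {-1<..<0})" "negligible ((?I \<union> {-1<..<0}) \<inter> {1<..})"
      "negligible (((?I \<union> {-1<..<0}) \<union> {1<..}) \<inter> {..<-1})" by simp_all
  qed
  have absU: "G absolutely_integrable_on ?U"
    by (intro set_integrable_Un assms(1) 2(1) 3(1) 4(1)) auto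
  have n: "negligible {x \<in> - {0} - ?U. G x \<noteq> 0}" "negligible {x \<in> ?U - - {0}. G x \<noteq> 0}"
    by (rule negligible_subset[of "{1, -1}"], simp, force)+
  show "G absolutely_integrable_on - {0}"
    using absU absolutely_integrable_spike_set_eq[of "- {0}" ?U G] n by (metis)
  show "integral (- {0}) G = integral {0<..<1} G + integral {0<..<1} (\<lambda>u. G (- u))
      + integral {0<..<1} (\<lambda>u. G (1 / u) / u\<^sup>2) + integral {0<..<1} (\<lambda>u. G (- 1 / u) / u\<^sup>2)"
    using integral_unique[OF U] integral_spike_set[OF n(2,1)] by metis
qed

lemma borel_set_integral_eq_integral:
  fixes G :: "real \<Rightarrow> complex"
  assumes "G absolutely_integrable_on S" "open S" "continuous_on S G"
  shows "(LBINT t:S. G t) = integral S G"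
proof -
  have "(\<lambda>t. indicator S t *\<^sub>R G t) \<in> borel_measurable lborel"
    using borel_measurable_continuous_on_indicator[of S G] assms(2,3) by simp
  then have "(LBINT t:S. G t) = (LINT t:S|lebesgue. G t)"
    unfolding set_lebesgue_integral_def by (rule integral_completion[symmetric])
  also have "\<dots> = integral S G" by (rule set_lebesgue_integral_eq_integral(2)[OF assms(1)])
  finally show ?thesis .
qed

lemma sabs_add: "x \<noteq> 0 \<Longrightarrow> sabs (a + b) (m + k) x = sabs a m x * sabs b k x"
  by (cases a; cases b) (auto simp: sabs_def rep_def powr_add sgn_if)

lemma sabs_inverse: "x \<noteq> 0 \<Longrightarrow> sabs a m (1 / x) = sabs a (- m) x"
proof -
  have "complex_of_real (1 / r) powr m = of_real r powr (- m)" if "r > 0" for r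
    using that by (simp add: powr_def Ln_of_real ln_div flip: of_real_divide)
  from this[of "\<bar>x\<bar>"] show "sabs a m (1 / x) = sabs a (- m) x" if "x \<noteq> 0"
    using that by (simp add: sabs_def sgn_divide abs_divide sgn_if)
qed

lemma sabs_pos: "x > 0 \<Longrightarrow> sabs a m x = of_real x powr m"
  by (simp add: sabs_def)

lemma sabs_minus: "sabs a m (- x) = (- 1) ^ rep a * sabs a m x"
  by (simp add: sabs_def rep_def sgn_minus)

lemma continuous_on_sabs: "continuous_on (- {0}) (sabs a m)"
proof -
  have "continuous_on (- {0}) (\<lambda>x. complex_of_real (sgn x) ^ rep a * of_real \<bar>x\<bar> powr m)"
    by (intro continuous_intros) auto
  then show ?thesis by (simp add: sabs_def[abs_def])
qed

context even_weight begin

text \<open>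
  Folding \<open>(-1,1)\<close> to \<open>(0,1)\<close> replaces \<open>f\<close> by its part of parity \<open>a\<close>, because the weight is even.
\<close>

lemma signed_mellin:
  fixes f g :: "real \<Rightarrow> complex" and s w :: complex
  assumes f: "Cinf_on UNIV f" and g: "even_Cinf g" and fg: "\<And>t. f t + (- 1) ^ rep a * f (- t) = of_real t ^ rep a * g t"
    and s: "Re s > 0"
  defines "G \<equiv> \<lambda>t. sabs a s t * (f t * of_real (q t) powr w) / of_real \<bar>t\<bar>"
  shows "G absolutely_integrable_on {0<..<1}" "(\<lambda>u. G (- u)) absolutely_integrable_on {0<..<1}"
    "integral {0<..<1} G + integral {0<..<1} (\<lambda>u. G (- u)) = mellin g (s + of_nat (rep a)) w"
proof -
  have ai: "(\<lambda>u. of_real u powr (s - 1) * (k u * of_real (q u) powr w)) absolutely_integrable_on {0<..<1}"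
    if "continuous_on UNIV k" for k
  proof -
    have "continuous_on {0..1} (\<lambda>u. k u * of_real (q u) powr w)"
      by (intro continuous_intros continuous_on_subset[OF that]) auto
    then have "bounded ((\<lambda>u. k u * of_real (q u) powr w) ` {0..1})"
      by (intro compact_imp_bounded compact_continuous_image) auto
    then obtain C where "\<forall>z \<in> (\<lambda>u. k u * of_real (q u) powr w) ` {0..1}. cmod z \<le> C"
      unfolding bounded_iff by blast
    then have C: "cmod (k u * of_real (q u) powr w) \<le> C" if "u \<in> {0..1}" for u
      using that by simp
    show ?thesis
    proof (rule measurable_bounded_by_integrable_imp_absolutely_integrable)
      show "(\<lambda>u. of_real u powr (s - 1) * (k u * of_real (q u) powr w)) \<in> borel_measurable (lebesgue_on {0<..<1})"
        by (intro continuous_imp_measurable_on_sets_lebesgue continuous_intros continuous_on_subset[OF that]) auto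
      have "(\<lambda>u. u powr (Re s - 1)) integrable_on {0..1}"
        using s by (intro integrable_on_powr_from_0) auto
      then show "(\<lambda>u. u powr (Re s - 1) * C) integrable_on {0<..<1}"
        unfolding integrable_on_open_interval_real by (rule integrable_on_mult_left)
      show "cmod (of_real u powr (s - 1) * (k u * of_real (q u) powr w)) \<le> u powr (Re s - 1) * C" if "u \<in> {0<..<1}" for u
        using that C[of u] by (auto simp: norm_mult norm_powr_real_powr intro!: mult_left_mono)
    qed simp
  qed
  have cf: "continuous_on UNIV f" using f by (rule Cinf_on_continuous)
  have cf': "continuous_on UNIV (\<lambda>u. (- 1) ^ rep a * f (- u))"
    by (intro continuous_intros continuous_on_compose2[OF cf]) auto
  have e1: "of_real u powr (s - 1) * (f u * of_real (q u) powr w) = G u" if "u \<in> {0<..<1}" for u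
    using that by (simp add: G_def sabs_pos powr_diff)
  have e2: "of_real u powr (s - 1) * ((- 1) ^ rep a * f (- u) * of_real (q u) powr w) = G (- u)" if "u \<in> {0<..<1}" for u
    using that q_even by (simp add: G_def sabs_minus sabs_pos powr_diff even_Cinf_def)
  show 1: "G absolutely_integrable_on {0<..<1}"
    by (rule absolutely_integrable_spike[OF ai[OF cf] negligible_empty]) (simp add: e1)
  show 2: "(\<lambda>u. G (- u)) absolutely_integrable_on {0<..<1}"
    by (rule absolutely_integrable_spike[OF ai[OF cf'] negligible_empty]) (simp add: e2)
  have "integral {0<..<1} G + integral {0<..<1} (\<lambda>u. G (- u)) = integral {0<..<1} (\<lambda>u. G u + G (- u))"
    using 1 2 by (intro integral_add[symmetric]) (auto simp: absolutely_integrable_on_def)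
  also have "\<dots> = integral {0<..<1} (\<lambda>u. of_real u powr (s + of_nat (rep a) - 1) * g u * of_real (q u) powr w)"
  proof (rule integral_cong)
    fix u :: real assume u: "u \<in> {0<..<1}"
    have "G u + G (- u) = of_real u powr (s - 1) * (f u + (- 1) ^ rep a * f (- u)) * of_real (q u) powr w"
      by (simp add: e1[OF u, symmetric] e2[OF u, symmetric] algebra_simps)
    also have "\<dots> = of_real u powr (s - 1) * of_real u ^ rep a * g u * of_real (q u) powr w"
      by (simp add: fg)
    also have "of_real u powr (s - 1) * of_real u ^ rep a = complex_of_real u powr (s - 1 + of_nat (rep a))"
      using u by (simp add: powr_add powr_nat')
    finally show "G u + G (- u) = of_real u powr (s + of_nat (rep a) - 1) * g u * of_real (q u) powr w"
      by (simp add: algebra_simps)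
  qed
  also have "\<dots> = mellin g (s + of_nat (rep a)) w"
    unfolding mellin_def by (simp only: integral_open_interval_real)
  finally show "integral {0<..<1} G + integral {0<..<1} (\<lambda>u. G (- u)) = mellin g (s + of_nat (rep a)) w" .
qed

end

section \<open>Block matrices, Gram determinants and the Iwasawa decomposition\<close>

lemma sum_UNIV_Plus:
  fixes f :: "'a::finite + 'b::finite \<Rightarrow> 'c::comm_monoid_add"
  shows "(\<Sum>k\<in>UNIV. f k) = (\<Sum>a\<in>UNIV. f (Inl a)) + (\<Sum>b\<in>UNIV. f (Inr b))"
  by (simp add: UNIV_Plus_UNIV[symmetric] sum.Plus comp_def del: UNIV_Plus_UNIV)

text \<open>
  The block diagonal matrix with block \<open>A\<close> on the indices in the range of \<open>f\<close> and the identity elsewhere. It serves for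
  both diagonal blocks of a \<open>2n \<times> 2n\<close> matrix, through \<open>Inl\<close> and \<open>Inr\<close>.
\<close>

definition embed :: "('a \<Rightarrow> 'b) \<Rightarrow> real^'a^'a \<Rightarrow> real^'b^'b" where
  "embed f A = (\<chi> i j. if i \<in> range f \<and> j \<in> range f then A $ inv f i $ inv f j
     else if i = j then 1 else 0)"

text \<open>
  Row operations and column swaps of \<open>A\<close> are operations of the same kind on \<open>embed f A\<close>, so that the claim reduces to
  diagonal matrices and to matrices with a zero row.
\<close>

lemma det_embed:
  fixes f :: "'a::finite \<Rightarrow> 'b::finite" and A :: "real^'a^'a"
  assumes "inj f"
  shows "det (embed f A) = det A"
proof (induction A rule: induct_matrix_row_operations)
  case (1 A i)
  have "row (f i) (embed f A) = 0"
    using 1 assms by (auto simp: row_def vec_eq_iff embed_def inv_f_f)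
  then show ?case using 1 by (simp add: det_zero_row)
next
  case (2 A)
  have ne: "inv f i \<noteq> inv f j" if "i \<in> range f" "j \<in> range f" "i \<noteq> j" for i j
    using that assms by (auto simp: inv_f_f)
  have "det (embed f A) = (\<Prod>i\<in>UNIV. embed f A $ i $ i)"
    using 2 ne by (intro det_diagonal) (auto simp: embed_def)
  also have "\<dots> = (\<Prod>i\<in>range f. A $ inv f i $ inv f i)"
    by (rule prod.mono_neutral_cong_right) (auto simp: embed_def)
  also have "\<dots> = (\<Prod>i\<in>UNIV. A $ i $ i)"
    using assms by (simp add: prod.reindex inv_f_f)
  finally show ?case using 2 by (simp add: det_diagonal)
next
  case (3 A m n)
  let ?t = "Transposition.transpose m n" and ?T = "Transposition.transpose (f m) (f n)"
  have T: "?T (f j) = f (?t j)" for j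
    using assms by (auto simp: Transposition.transpose_def inj_eq)
  have T': "?T j = j" if "j \<notin> range f" for j
    using that by (auto simp: Transposition.transpose_def)
  have "embed f (\<chi> i j. A $ i $ ?t j) $ i $ j = embed f A $ i $ ?T j" for i j
  proof (cases "j \<in> range f")
    case True
    then obtain b where b: "j = f b" by auto
    show ?thesis using assms by (auto simp: embed_def b T inv_f_f)
  next
    case False
    then show ?thesis by (auto simp: embed_def T')
  qed
  then have "embed f (\<chi> i j. A $ i $ ?t j) = (\<chi> i j. embed f A $ i $ ?T j)"
    by (simp add: vec_eq_iff)
  then show ?case using 3 assms
    by (simp add: det_permute_columns permutes_swap_id sign_swap_id inj_eq)
next
  case (4 A m n c)
  have "embed f (\<chi> i. if i = m then row m A + c *\<^sub>R row n A else row i A)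
     = (\<chi> i. if i = f m then row (f m) (embed f A) + c *s row (f n) (embed f A) else row i (embed f A))"
    using assms 4 by (auto simp: embed_def vec_eq_iff row_def inv_f_f inj_eq)
  moreover have "(\<chi> i. if i = m then row m A + c *\<^sub>R row n A else row i A)
     = (\<chi> i. if i = m then row m A + c *s row n A else row i A)"
    by (simp add: vec_eq_iff row_def)
  ultimately show ?case using 4 assms by (simp add: det_row_operation inj_eq)
qed

lemma upper_block_nth [simp]:
  "upper_block A X B $ Inl i $ Inl j = A $ i $ j" "upper_block A X B $ Inl i $ Inr l = X $ i $ l"
  "upper_block A X B $ Inr k $ Inl j = 0" "upper_block A X B $ Inr k $ Inr l = B $ k $ l"
  by (simp_all add: upper_block_def)

lemma block_ext:
  fixes M N :: "'n::finite mat2"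
  assumes "\<And>i j. M $ Inl i $ Inl j = N $ Inl i $ Inl j" "\<And>i j. M $ Inl i $ Inr j = N $ Inl i $ Inr j"
    "\<And>i j. M $ Inr i $ Inl j = N $ Inr i $ Inl j" "\<And>i j. M $ Inr i $ Inr j = N $ Inr i $ Inr j"
  shows "M = N"
proof -
  have "M $ i $ j = N $ i $ j" for i j using assms by (cases i; cases j) auto
  then show ?thesis by (simp add: vec_eq_iff)
qed

lemma upper_block_mult:
  fixes A B C D X Y :: "real^'n::finite^'n"
  shows "upper_block A X B ** upper_block C Y D = upper_block (A ** C) (A ** Y + X ** D) (B ** D)"
  by (rule block_ext) (auto simp: matrix_matrix_mult_def sum_UNIV_Plus)

text \<open>
  The matrix is a product of two block diagonal matrices and a unipotent one. The unipotent factor \<open>u(X)\<close> has determinant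
  \<open>1\<close>: it is conjugate to \<open>u(2X)\<close>, which is also its square.
\<close>

lemma det_upper_block:
  fixes A B X :: "real^'n::finite^'n"
  shows "det (upper_block A X B) = det A * det B"
proof -
  let ?u = "\<lambda>X. upper_block (mat 1) X (mat 1) :: 'n mat2"
  let ?d = "\<lambda>c. upper_block (c *\<^sub>R mat 1) 0 (mat 1) :: 'n mat2"
  have one: "?u 0 = mat 1" by (rule block_ext) (auto simp: mat_def)
  have A: "det (upper_block A 0 (mat 1)) = det A"
    by (subst det_embed[of Inl A, symmetric])
      (auto intro!: arg_cong[of _ _ det] block_ext simp: embed_def inv_f_f mat_def)
  have B: "det (upper_block (mat 1) 0 B) = det B"
    by (subst det_embed[of Inr B, symmetric])
      (auto intro!: arg_cong[of _ _ det] block_ext simp: embed_def inv_f_f mat_def)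
  have sc: "(c *\<^sub>R mat 1) ** Y = c *\<^sub>R Y" "Y ** (c *\<^sub>R mat 1) = c *\<^sub>R Y" for c and Y :: "real^'n^'n"
    by (auto simp: vec_eq_iff matrix_matrix_mult_def mat_def if_distrib if_distribR cong: if_cong)
  have "?u X ** ?u (- X) = mat 1" using one by (simp add: upper_block_mult)
  then have "det (?u X) * det (?u (- X)) = 1" by (metis det_I det_mul)
  then have nz: "det (?u X) \<noteq> 0" by auto
  have sq: "?u X ** ?u X = ?u (2 *\<^sub>R X)"
    by (simp add: upper_block_mult scaleR_2)
  have conj: "?d 2 ** ?u X = ?u (2 *\<^sub>R X) ** ?d 2"
    by (simp add: upper_block_mult sc)
  have "det (?d 2) \<noteq> 0"
  proof -
    have "?d (1/2) ** ?d 2 = mat 1"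
      using one by (simp add: upper_block_mult sc)
    then have "det (?d (1/2)) * det (?d 2) = 1" by (metis det_I det_mul)
    then show ?thesis by auto
  qed
  moreover have "det (?d 2) * det (?u X) = det (?u X) * det (?u X) * det (?d 2)"
    using arg_cong[OF conj, of det] arg_cong[OF sq, of det] by (simp add: det_mul)
  ultimately have u: "det (?u X) = 1" using nz by simp
  have "upper_block A X B = upper_block (mat 1) 0 B ** (?u X ** upper_block A 0 (mat 1))"
    by (simp add: upper_block_mult)
  then show ?thesis by (simp add: det_mul A B u)
qed

lemma GL_iff_det: "g \<in> GL \<longleftrightarrow> det g \<noteq> 0"
  by (simp add: GL_def invertible_det_nz)

definition gram :: "'n::finite mat2 \<Rightarrow> real^'n^'n" where
  "gram g = (\<chi> i j. \<Sum>k\<in>UNIV. g $ k $ Inl i * g $ k $ Inl j)"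

lemma gram_nth: "gram g $ i $ j = (transpose g ** g) $ Inl i $ Inl j"
  by (simp add: gram_def matrix_matrix_mult_def transpose_def)

lemma gram_orthogonal: "orthogonal_matrix k \<Longrightarrow> gram k = mat 1"
  by (simp add: vec_eq_iff gram_nth orthogonal_matrix) (simp add: mat_def)

text \<open>
  The first \<open>n\<close> columns of the product are the first \<open>n\<close> columns of \<open>g\<close> times \<open>A\<close>.
\<close>

lemma gram_mult_upper_block:
  fixes g :: "'n::finite mat2"
  shows "gram (g ** upper_block A X B) = transpose A ** gram g ** A"
proof -
  have 1: "(g ** upper_block A X B) $ k $ Inl j = (\<Sum>b\<in>UNIV. g $ k $ Inl b * A $ b $ j)" for k j
    by (simp add: matrix_matrix_mult_def sum_UNIV_Plus)
  have "gram (g ** upper_block A X B) $ i $ j = (transpose A ** gram g ** A) $ i $ j" for i j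
  proof -
    have "gram (g ** upper_block A X B) $ i $ j
       = (\<Sum>k\<in>UNIV. \<Sum>a\<in>UNIV. \<Sum>b\<in>UNIV. g $ k $ Inl a * A $ a $ i * (g $ k $ Inl b * A $ b $ j))"
      by (simp add: gram_def 1 sum_product)
    also have "\<dots> = (\<Sum>a\<in>UNIV. \<Sum>k\<in>UNIV. \<Sum>b\<in>UNIV. g $ k $ Inl a * A $ a $ i * (g $ k $ Inl b * A $ b $ j))"
      by (rule sum.swap)
    also have "\<dots> = (\<Sum>a\<in>UNIV. \<Sum>b\<in>UNIV. \<Sum>k\<in>UNIV. g $ k $ Inl a * A $ a $ i * (g $ k $ Inl b * A $ b $ j))"
      by (intro sum.cong refl sum.swap)
    also have "\<dots> = (\<Sum>b\<in>UNIV. \<Sum>a\<in>UNIV. \<Sum>k\<in>UNIV. g $ k $ Inl a * A $ a $ i * (g $ k $ Inl b * A $ b $ j))"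
      by (rule sum.swap)
    also have "\<dots> = (transpose A ** gram g ** A) $ i $ j"
      by (simp add: matrix_matrix_mult_def transpose_def gram_def sum_distrib_left sum_distrib_right mult_ac)
    finally show ?thesis .
  qed
  then show ?thesis by (simp add: vec_eq_iff)
qed

lemma det_gram_mult_upper_block:
  "det (gram (g ** upper_block A X B)) = (det A)\<^sup>2 * det (gram g)"
  by (simp add: gram_mult_upper_block det_mul power2_eq_square)

definition pad_zero :: "real^'n::finite \<Rightarrow> real^('n + 'n)" where
  "pad_zero v = (\<chi> i. case i of Inl a \<Rightarrow> v $ a | Inr b \<Rightarrow> 0)"

text \<open>
  Let \<open>V\<close> be the span of the first \<open>n\<close> columns of \<open>g\<close>. An orthogonal \<open>k\<close> that maps the first coordinate subspace onto \<open>V\<close>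
  and the second onto its orthogonal complement makes the lower left block of \<open>k\<inverse> g\<close> zero.
\<close>

lemma Iwasawa_block:
  fixes g :: "'n::finite mat2"
  assumes "g \<in> GL"
  obtains k A X B where "orthogonal_matrix k" "A \<in> GL" "B \<in> GL" "g = k ** upper_block A X B"
proof -
  define V where "V = range (\<lambda>v. g *v pad_zero v)"
  have J: "linear (pad_zero :: real^'n \<Rightarrow> _)"
    by (rule linearI) (auto simp: pad_zero_def vec_eq_iff split: sum.split)
  have lin: "linear (\<lambda>v. g *v pad_zero v)"
    using linear_compose[OF J matrix_vector_mul_linear[of g]] by (simp add: comp_def)
  have inj: "inj (\<lambda>v. g *v pad_zero v)"
  proof (rule injI)
    fix u v :: "real^'n" assume "g *v pad_zero u = g *v pad_zero v"
    then have "pad_zero u = pad_zero v"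
      using assms by (metis GL_def inj_eq inj_matrix_vector_mult mem_Collect_eq)
    then have "pad_zero u $ Inl a = pad_zero v $ Inl a" for a by simp
    then show "u = v" by (simp add: pad_zero_def vec_eq_iff)
  qed
  have V: "subspace V" unfolding V_def by (intro linear_subspace_image lin subspace_UNIV)
  have dimV: "dim V = dim (UNIV :: (real^'n) set)"
    unfolding V_def by (intro dim_image_eq lin) (use inj in \<open>simp add: inj_on_def\<close>)
  define V' where "V' = {y\<in>UNIV. \<forall>x\<in>V. orthogonal x y}"
  have V': "subspace V'" unfolding V'_def by (simp add: subspace_orthogonal_to_vectors)
  have "dim V' + dim V = dim (UNIV :: (real^('n+'n)) set)"
    unfolding V'_def by (intro dim_subspace_orthogonal_to_vectors V) auto
  then have dimV': "dim V' = dim (UNIV :: (real^'n) set)" using dimV by simp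
  obtain f where f: "linear f" "range f = V" "\<And>x::real^'n. norm (f x) = norm x"
    using isometries_subspaces[OF subspace_UNIV V dimV[symmetric]] by (metis UNIV_I)
  obtain f' where f': "linear f'" "range f' = V'" "\<And>x::real^'n. norm (f' x) = norm x"
    using isometries_subspaces[OF subspace_UNIV V' dimV'[symmetric]] by (metis UNIV_I)
  let ?p = "\<lambda>z. \<chi> a. z $ Inl a" and ?p' = "\<lambda>z. \<chi> a. z $ Inr a"
  define T where "T z = f (?p z) + f' (?p' z)" for z :: "real^('n+'n)"
  have lp: "linear (?p :: real^('n+'n) \<Rightarrow> _)" "linear (?p' :: real^('n+'n) \<Rightarrow> _)"
    by (auto intro!: linearI simp: vec_eq_iff)
  have "linear T" unfolding T_def[abs_def]
    by (intro linear_compose_add linear_compose[OF lp(1) f(1), unfolded comp_def]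
        linear_compose[OF lp(2) f'(1), unfolded comp_def])
  moreover have "norm (T z) = norm z" for z
  proof -
    have "f (?p z) \<in> V" "f' (?p' z) \<in> V'" using f(2) f'(2) by auto
    then have "orthogonal (f (?p z)) (f' (?p' z))" by (auto simp: V'_def)
    then have "(norm (T z))\<^sup>2 = (norm (?p z))\<^sup>2 + (norm (?p' z))\<^sup>2"
      unfolding T_def by (subst norm_add_Pythagorean) (simp_all add: f(3) f'(3))
    also have "\<dots> = (norm z)\<^sup>2"
      by (simp add: power2_norm_eq_inner inner_vec_def sum_UNIV_Plus)
    finally show ?thesis by simp
  qed
  ultimately have ortho: "orthogonal_matrix (matrix T)"
    using orthogonal_transformation orthogonal_transformation_matrix by blast
  define k where "k = matrix T"
  have k: "transpose k ** k = mat 1" "k ** transpose k = mat 1"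
    using ortho by (auto simp: k_def orthogonal_matrix_def)
  define M where "M = transpose k ** g"
  have gM: "g = k ** M" by (simp add: M_def matrix_mul_assoc k)
  have "M $ Inr b $ Inl a = 0" for a b
  proof -
    have "M $ Inr b $ Inl a = column (Inr b) k \<bullet> column (Inl a) g"
      by (simp add: M_def matrix_matrix_mult_def transpose_def inner_vec_def column_def)
    moreover have "column (Inr b) k \<in> V'"
    proof -
      let ?e = "axis (Inr b) 1 :: real^('n+'n)"
      have "?p ?e = 0" by (simp add: vec_eq_iff axis_def)
      then have "T ?e = f' (?p' ?e)" by (simp add: T_def linear_0[OF f(1)])
      moreover have "column (Inr b) k = T ?e"
        by (simp add: k_def matrix_def column_def vec_eq_iff)
      ultimately show ?thesis using f'(2) by auto
    qed
    moreover have "column (Inl a) g \<in> V"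
    proof -
      have "column (Inl a) g = g *v pad_zero (axis a 1)"
        by (simp add: matrix_vector_mult_def column_def vec_eq_iff sum_UNIV_Plus pad_zero_def axis_def
            if_distrib cong: if_cong)
      then show ?thesis by (auto simp: V_def)
    qed
    ultimately show ?thesis by (simp add: V'_def orthogonal_def inner_commute)
  qed
  then have M: "M = upper_block (\<chi> i j. M $ Inl i $ Inl j) (\<chi> i j. M $ Inl i $ Inr j) (\<chi> i j. M $ Inr i $ Inr j)"
    (is "M = upper_block ?A ?X ?B")
    by (intro block_ext) auto
  have "det g \<noteq> 0" using assms by (simp add: GL_iff_det)
  then have "det M \<noteq> 0" unfolding gM det_mul by simp
  then have "det ?A \<noteq> 0" "det ?B \<noteq> 0" by (subst (asm) M, simp add: det_upper_block)+
  then show thesis using that[of k ?A ?B ?X] ortho gM M by (simp add: GL_iff_det k_def)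
qed

lemma open_GL: "open (GL :: (real^'m^'m) set)"
proof -
  have "continuous_on UNIV (det :: real^'m^'m \<Rightarrow> real)"
    using Ck_on_det[where k = 0, OF open_UNIV Ck_on_entry[OF open_UNIV]]
    by (simp only: Ck_on.simps)
  then have "open (det -` (- {0}) :: (real^'m^'m) set)"
    by (intro open_vimage) auto
  moreover have "det -` (- {0}) = (GL :: (real^'m^'m) set)" by (auto simp: GL_iff_det)
  ultimately show ?thesis by simp
qed

lemma orthogonal_GL: "orthogonal_matrix k \<Longrightarrow> k \<in> GL"
  by (auto simp: GL_def orthogonal_matrix_def invertible_def)

text \<open>
  By the Iwasawa decomposition the Gram determinant is the square of the determinant of an invertible block.
\<close>

lemma det_gram_pos:
  fixes g :: "'n::finite mat2"
  assumes "g \<in> GL" shows "det (gram g) > 0"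
proof -
  obtain k A X B where "orthogonal_matrix k" "A \<in> GL" "g = k ** upper_block A X B"
    using Iwasawa_block[OF assms] by metis
  then show ?thesis
    by (simp add: det_gram_mult_upper_block gram_orthogonal GL_iff_det)
qed

lemma Ck_on_det_gram: "open S \<Longrightarrow> Ck_on k S (\<lambda>g::'n::finite mat2. det (gram g))"
  by (intro Ck_on_det) (auto simp: gram_def intro!: Ck_on_sum Ck_on_mult Ck_on_entry)

section \<open>The line of integration and its chart at infinity\<close>

lemma matrix_mult_add_scaleR:
  fixes A B :: "real^'k::finite^'l::finite" and C :: "real^'m::finite^'k" and D :: "real^'l^'m"
  shows "(A + c *\<^sub>R B) ** C = A ** C + c *\<^sub>R (B ** C)" "D ** (A + c *\<^sub>R B) = D ** A + c *\<^sub>R (D ** B)"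
  by (simp_all add: vec_eq_iff matrix_matrix_mult_def sum.distrib sum_distrib_left algebra_simps)

text \<open>
  In the coordinates \<open>n\<close> and \<open>2n\<close> this is the matrix with rows \<open>(u, -1)\<close> and \<open>(1, 0)\<close>. The factorization into shears shows at
  once that the determinant is \<open>1\<close> and that the dependence on \<open>u\<close> is affine.
\<close>

definition chart_at_infinity :: "real \<Rightarrow> 'n::{finite,linorder} mat2" where
  "chart_at_infinity u = (mat 1 + (u - 1) *\<^sub>R transpose E_last) ** (mat 1 + 1 *\<^sub>R E_last) ** (mat 1 + (-1) *\<^sub>R transpose E_last)"

lemma det_shear:
  shows "det (mat 1 + t *\<^sub>R E_last :: 'n::{finite,linorder} mat2) = 1"
    and "det (mat 1 + t *\<^sub>R transpose E_last :: 'n::{finite,linorder} mat2) = 1"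
proof -
  let ?M = "mat 1 + t *\<^sub>R E_last :: 'n mat2" and ?m = "Inr (Max UNIV) :: 'n + 'n" and ?n = "Inl (Max UNIV) :: 'n + 'n"
  have "?M = (\<chi> k. if k = ?m then row ?m (mat 1) + t *s row ?n (mat 1) else row k (mat 1))"
    by (auto simp: vec_eq_iff row_def mat_def E_last_def)
  also have "det \<dots> = det (mat 1 :: 'n mat2)" by (rule det_row_operation) simp
  finally show 1: "det ?M = 1" by simp
  have "mat 1 + t *\<^sub>R transpose E_last = transpose ?M"
    by (auto simp: vec_eq_iff transpose_def mat_def)
  then show "det (mat 1 + t *\<^sub>R transpose E_last :: 'n mat2) = 1"
    by (metis 1 det_transpose)
qed

lemma det_chart_at_infinity: "det (chart_at_infinity u) = 1"
  by (simp only: chart_at_infinity_def det_mul det_shear mult_1)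

lemma chart_at_infinity_nth:
  fixes i j :: "'n::{finite,linorder} + 'n::{finite,linorder}"
  shows "(chart_at_infinity u :: 'n::{finite,linorder} mat2) $ i $ j =
    (if i = Inl (Max UNIV) then (if j = Inl (Max UNIV) then u else if j = Inr (Max UNIV) then -1 else 0)
     else if i = Inr (Max UNIV) then (if j = Inl (Max UNIV) then 1 else 0)
     else if i = j then 1 else 0)"
proof -
  let ?m = "Inr (Max UNIV) :: 'n + 'n" and ?n = "Inl (Max UNIV) :: 'n + 'n"
  have E: "(A ** E_last) $ i $ j = (if j = ?n then A $ i $ ?m else 0)" for A :: "'n mat2" and i j
    by (auto simp: matrix_matrix_mult_def E_last_def if_distrib cong: if_cong)
  have E': "(A ** transpose E_last) $ i $ j = (if j = ?m then A $ i $ ?n else 0)" for A :: "'n mat2" and i j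
    by (auto simp: matrix_matrix_mult_def transpose_def E_last_def if_distrib cong: if_cong)
  have "(mat 1 + (u - 1) *\<^sub>R transpose E_last :: 'n mat2) $ i $ j
     = (if i = ?n \<and> j = ?m then u - 1 else if i = j then 1 else 0)" for i j
    by (auto simp: transpose_def E_last_def mat_def)
  then show ?thesis
    unfolding chart_at_infinity_def matrix_mult_add_scaleR(2) matrix_mul_rid vector_add_component
      vector_scaleR_component E E'
    by auto
qed

text \<open>
  In the coordinates \<open>n\<close> and \<open>2n\<close> the upper triangular factor has rows \<open>(1/t, -1)\<close> and \<open>(0, t)\<close>; elsewhere it is the identity.
\<close>

lemma shear_eq_chart_at_infinity:
  assumes "t \<noteq> 0"
  obtains A X B :: "((real, 'n::{finite,linorder}) vec, 'n) vec" where "det A = 1 / t" "det B = t"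
    "chart_at_infinity (1 / t) = (mat 1 + t *\<^sub>R E_last) ** upper_block A X B"
proof -
  let ?N = "Max UNIV :: 'n"
  define D where "D c = (\<chi> i j. if i = j then (if i = ?N then c else 1) else 0 :: ((real, 'n) vec, 'n) vec)" for c :: real
  have D: "det (D c) = c" for c
  proof -
    have "det (D c) = (\<Prod>i\<in>UNIV. if i = ?N then c else 1)"
      by (subst det_diagonal) (auto simp: D_def intro!: prod.cong)
    then show ?thesis by simp
  qed
  let ?X = "\<chi> i j. if i = ?N \<and> j = ?N then - 1 else 0 :: ((real, 'n) vec, 'n) vec"
  let ?U = "upper_block (D (1 / t)) ?X (D t)"
  have E: "(E_last ** A) $ i $ j = (if i = Inr ?N then A $ Inl ?N $ j else 0)" for A :: "'n mat2" and i j
    by (auto simp: matrix_matrix_mult_def E_last_def if_distrib if_distribR cong: if_cong)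
  have "chart_at_infinity (1 / t) = ?U + t *\<^sub>R (E_last ** ?U)"
    using assms by (intro block_ext) (auto simp: chart_at_infinity_nth E D_def)
  also have "\<dots> = (mat 1 + t *\<^sub>R E_last) ** ?U"
    by (simp add: matrix_mult_add_scaleR)
  finally show thesis using that D by blast
qed

lemma shear_curve_affine:
  "(h :: 'n::{finite,linorder} mat2) ** (mat 1 + t *\<^sub>R E_last) = h + t *\<^sub>R (h ** E_last)"
  by (simp add: matrix_mult_add_scaleR)

lemma chart_at_infinity_affine:
  fixes h :: "'n::{finite,linorder} mat2"
  obtains A B where "\<And>u. h ** chart_at_infinity u = A + u *\<^sub>R B"
proof -
  let ?S = "(mat 1 + 1 *\<^sub>R E_last) ** (mat 1 + (-1) *\<^sub>R transpose E_last) :: 'n mat2"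
  have "chart_at_infinity u = (mat 1 + (-1) *\<^sub>R transpose E_last) ** ?S + u *\<^sub>R (transpose E_last ** ?S)" for u
    unfolding chart_at_infinity_def matrix_mul_assoc[symmetric] matrix_mult_add_scaleR(1) by (simp add: algebra_simps)
  then have "h ** chart_at_infinity u = h ** ((mat 1 + (-1) *\<^sub>R transpose E_last) ** ?S)
      + u *\<^sub>R (h ** (transpose E_last ** ?S))" for u
    by (simp only: matrix_mult_add_scaleR(2))
  then show thesis using that by blast
qed

lemma shear_curve_GL: "h \<in> GL \<Longrightarrow> (h :: 'n::{finite,linorder} mat2) ** (mat 1 + t *\<^sub>R E_last) \<in> GL"
  by (simp add: GL_iff_det det_mul det_shear)

lemma chart_at_infinity_GL: "h \<in> GL \<Longrightarrow> (h :: 'n::{finite,linorder} mat2) ** chart_at_infinity u \<in> GL"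
  by (simp add: GL_iff_det det_mul det_chart_at_infinity)

text \<open>
  The last row and the last column of \<open>h\<close> are those of the identity, so \<open>t\<close> enters the first \<open>n\<close> columns through a
  single entry, in a row where the other entries of these columns vanish. Hence it enters the Gram matrix only as \<open>t\<^sup>2\<close>.
\<close>

lemma even_weight_shear:
  fixes h :: "'n::{finite,linorder} mat2"
  assumes "h \<in> GL_corner"
  shows "even_weight (\<lambda>t. det (gram (h ** (mat 1 + t *\<^sub>R E_last))))"
proof
  let ?m = "Inr (Max UNIV) :: 'n + 'n" and ?N = "Max UNIV :: 'n"
  have h: "h \<in> GL" "h $ i $ ?m = (if i = ?m then 1 else 0)" "h $ ?m $ i = (if i = ?m then 1 else 0)" for i
    using assms by (auto simp: GL_corner_def)
  let ?c = "\<lambda>t. h ** (mat 1 + t *\<^sub>R E_last)"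
  have "Cinf_on UNIV (\<lambda>g::'n mat2. det (gram g))" by (simp add: Cinf_on_def Ck_on_det_gram)
  from Cinf_on_affine[OF this, of h "h ** E_last"]
  have "Cinf_on UNIV (\<lambda>t. det (gram (?c t)))" by (simp add: shear_curve_affine)
  moreover have "gram (?c (- t)) = gram (?c t)" for t
  proof -
    define C where "C = ?c"
    have "(h ** E_last) $ i $ j = (if j = Inl ?N then h $ i $ ?m else 0)" for i j
      by (auto simp: matrix_matrix_mult_def E_last_def if_distrib cong: if_cong)
    then have c: "C t $ k $ Inl j = (if k = ?m then (if j = ?N then t else 0) else h $ k $ Inl j)" for k j t
      by (simp add: C_def shear_curve_affine h(2,3))
    have "gram (C (- t)) = gram (C t)" by (auto simp: gram_def vec_eq_iff c intro!: sum.cong)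
    then show ?thesis by (simp add: C_def)
  qed
  ultimately show "even_Cinf (\<lambda>t. det (gram (?c t)))" by (simp add: even_Cinf_def)
  show "det (gram (?c t)) > 0" for t by (intro det_gram_pos shear_curve_GL h)
qed

lemma det_gram_chart_at_infinity:
  fixes h :: "'n::{finite,linorder} mat2"
  assumes "u \<noteq> 0"
  shows "det (gram (h ** chart_at_infinity u)) = u\<^sup>2 * det (gram (h ** (mat 1 + (1 / u) *\<^sub>R E_last)))"
proof -
  obtain A X B :: "((real, 'n) vec, 'n) vec" where AB: "det A = 1 / (1 / u)" "det B = 1 / u"
    "chart_at_infinity (1 / (1 / u)) = (mat 1 + (1 / u) *\<^sub>R E_last) ** upper_block A X B"
    using shear_eq_chart_at_infinity[of "1 / u"] assms by (metis divide_eq_0_iff zero_neq_one)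
  have "h ** chart_at_infinity u = h ** (mat 1 + (1 / u) *\<^sub>R E_last) ** upper_block A X B"
    using AB(3) by (simp add: matrix_mul_assoc)
  then show ?thesis using AB(1) by (simp only: det_gram_mult_upper_block) simp
qed

text \<open>
  Here the Gram matrix itself may depend on the sign of \<open>u\<close>. Its determinant is even because for \<open>u \<noteq> 0\<close> it is \<open>u\<^sup>2\<close> times the
  value of the even function of \<open>even_weight_shear\<close> at \<open>1/u\<close>.
\<close>

lemma even_weight_chart_at_infinity:
  fixes h :: "'n::{finite,linorder} mat2"
  assumes "h \<in> GL_corner"
  shows "even_weight (\<lambda>u. det (gram (h ** chart_at_infinity u)))"
proof
  let ?c = "\<lambda>u. h ** chart_at_infinity u"
  have "Cinf_on UNIV (\<lambda>g::'n mat2. det (gram g))" by (simp add: Cinf_on_def Ck_on_det_gram)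
  moreover obtain A B where "\<And>u. h ** chart_at_infinity u = A + u *\<^sub>R B" using chart_at_infinity_affine[of h] by metis
  ultimately have "Cinf_on UNIV (\<lambda>t. det (gram (?c t)))" using Cinf_on_affine[of UNIV "\<lambda>g. det (gram g)" A B] by simp
  moreover have "det (gram (?c (- u))) = det (gram (?c u))" for u
  proof (cases "u = 0")
    case False
    have ev: "det (gram (h ** (mat 1 + (- t) *\<^sub>R E_last))) = det (gram (h ** (mat 1 + t *\<^sub>R E_last)))" for t
      using even_weight.q_even[OF even_weight_shear[OF assms]] unfolding even_Cinf_def by blast
    have "1 / (- u) = - (1 / u)" by simp
    then have "det (gram (?c (- u))) = (- u)\<^sup>2 * det (gram (h ** (mat 1 + (- (1 / u)) *\<^sub>R E_last)))"
      using det_gram_chart_at_infinity[of "- u" h] False by (simp only: neg_equal_0_iff_equal not_False_eq_True)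
    also have "\<dots> = det (gram (?c u))"
      unfolding ev using det_gram_chart_at_infinity[OF False, of h] by simp
    finally show ?thesis .
  qed simp
  ultimately show "even_Cinf (\<lambda>u. det (gram (?c u)))" by (simp add: even_Cinf_def)
  show "det (gram (?c t)) > 0" for t using assms by (intro det_gram_pos chart_at_infinity_GL) (simp add: GL_corner_def)
qed

section \<open>The principal series in the compact picture\<close>

lemma of_real_powr_sq_mult:
  assumes "a \<noteq> 0" "r > 0"
  shows "complex_of_real (a\<^sup>2 * r) powr w = of_real \<bar>a\<bar> powr (2 * w) * of_real r powr w"
proof -
  have powr_eq: "complex_of_real x powr z = exp (z * of_real (ln x))" if "x > 0" for x z
    using that by (simp add: powr_def Ln_of_real)
  have "ln (a\<^sup>2 * r) = 2 * ln \<bar>a\<bar> + ln r"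
    using assms ln_realpow[of "\<bar>a\<bar>" 2] by (simp add: ln_mult)
  then have "complex_of_real (a\<^sup>2 * r) powr w = exp (w * of_real (2 * ln \<bar>a\<bar> + ln r))"
    using powr_eq[of "a\<^sup>2 * r" w] assms by simp
  also have "\<dots> = of_real \<bar>a\<bar> powr (2 * w) * of_real r powr w"
    using assms by (simp add: powr_eq algebra_simps flip: exp_add)
  finally show ?thesis .
qed

lemma sabs_mult_powr: "x \<noteq> 0 \<Longrightarrow> sabs a m x * of_real \<bar>x\<bar> powr k = sabs a (m + k) x"
  by (simp add: sabs_def powr_add)

text \<open>
  For suitable exponents this changes the inducing parameters of \<open>f\<close> without changing its restriction to the orthogonal group. The
  squared determinant is used because complex powers of it are smooth on all of \<open>GL\<close>.
\<close>

definition compact_transport :: "complex \<Rightarrow> complex \<Rightarrow> ('n::finite mat2 \<Rightarrow> complex) \<Rightarrow> 'n mat2 \<Rightarrow> complex" where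
  "compact_transport w v f g = f g * of_real (det (gram g)) powr w * of_real ((det g)\<^sup>2) powr v"

lemma principal_seriesD:
  assumes "f \<in> principal_series x1 x2 l1 l2"
  shows "Cinf_on GL f"
    "g \<in> GL \<Longrightarrow> A \<in> GL \<Longrightarrow> B \<in> GL \<Longrightarrow> f (g ** upper_block A X B) =
      sabs x1 (- l1 - of_nat CARD('n) / 2) (det A) * sabs x2 (- l2 + of_nat CARD('n) / 2) (det B) * f (g :: 'n::finite mat2)"
  using assms unfolding principal_series_def by blast+

lemma compact_transport_principal_series:
  assumes f: "f \<in> principal_series x1 x2 l1 l2"
  shows "compact_transport ((l1 - m1 - l2 + m2) / 2) ((l2 - m2) / 2) f \<in> principal_series x1 x2 m1 m2"
  (is "compact_transport ?w ?v f \<in> _")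
  unfolding principal_series_def
proof (intro CollectI conjI ballI allI)
  have d: "Ck_on k GL (\<lambda>g :: 'a mat2. (det g)\<^sup>2)" for k
    unfolding power2_eq_square by (intro Ck_on_mult open_GL Ck_on_det Ck_on_entry)
  have "Ck_on k GL (compact_transport ?w ?v f)" for k
    unfolding compact_transport_def[abs_def] using principal_seriesD(1)[OF f]
    by (intro Ck_on_mult Ck_on_powr open_GL Ck_on_det_gram d)
      (auto simp: Cinf_on_def det_gram_pos GL_iff_det)
  then show "Cinf_on GL (compact_transport ?w ?v f)" by (simp add: Cinf_on_def)
next
  fix g :: "'a mat2" and A B X :: "((real, 'a) vec, 'a) vec"
  assume g: "g \<in> GL" and A: "A \<in> GL" and B: "B \<in> GL"
  let ?a = "det A" and ?b = "det B" and ?n = "of_nat CARD('a) / 2 :: complex"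
  have nz: "?a \<noteq> 0" "?b \<noteq> 0" "det g \<noteq> 0" using g A B by (auto simp: GL_iff_det)
  have Q: "complex_of_real (det (gram (g ** upper_block A X B))) powr ?w
     = of_real \<bar>?a\<bar> powr (2 * ?w) * of_real (det (gram g)) powr ?w"
    unfolding det_gram_mult_upper_block using nz det_gram_pos[OF g] by (intro of_real_powr_sq_mult) auto
  have "(det (g ** upper_block A X B))\<^sup>2 = ?a\<^sup>2 * (?b\<^sup>2 * (det g)\<^sup>2)"
    by (simp add: det_mul det_upper_block power_mult_distrib)
  then have D: "complex_of_real ((det (g ** upper_block A X B))\<^sup>2) powr ?v
     = of_real \<bar>?a\<bar> powr (2 * ?v) * (of_real \<bar>?b\<bar> powr (2 * ?v) * of_real ((det g)\<^sup>2) powr ?v)"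
    using nz by (simp only:, subst of_real_powr_sq_mult, simp, simp, subst of_real_powr_sq_mult) simp_all
  have "compact_transport ?w ?v f (g ** upper_block A X B)
     = (sabs x1 (- l1 - ?n) ?a * of_real \<bar>?a\<bar> powr (2 * ?w) * of_real \<bar>?a\<bar> powr (2 * ?v)) *
       (sabs x2 (- l2 + ?n) ?b * of_real \<bar>?b\<bar> powr (2 * ?v)) * compact_transport ?w ?v f g"
    unfolding compact_transport_def Q D principal_seriesD(2)[OF f g A B] by (simp only: mult_ac)
  also have "sabs x1 (- l1 - ?n) ?a * of_real \<bar>?a\<bar> powr (2 * ?w) * of_real \<bar>?a\<bar> powr (2 * ?v) = sabs x1 (- m1 - ?n) ?a"
    by (simp only: sabs_mult_powr[OF nz(1)]) (simp add: add_divide_distrib diff_divide_distrib algebra_simps)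
  also have "sabs x2 (- l2 + ?n) ?b * of_real \<bar>?b\<bar> powr (2 * ?v) = sabs x2 (- m2 + ?n) ?b"
    by (simp only: sabs_mult_powr[OF nz(2)]) (simp add: add_divide_distrib diff_divide_distrib algebra_simps)
  finally show "compact_transport ?w ?v f (g ** upper_block A X B)
     = sabs x1 (- m1 - ?n) ?a * sabs x2 (- m2 + ?n) ?b * compact_transport ?w ?v f g" .
qed

lemma compact_transport_orthogonal: "orthogonal_matrix k \<Longrightarrow> compact_transport w v f k = f k"
  using det_orthogonal_matrix[of k] by (auto simp: compact_transport_def gram_orthogonal)

lemma principal_series_eqI:
  fixes f :: "'n::finite mat2 \<Rightarrow> complex"
  assumes "f \<in> principal_series x1 x2 l1 l2" "f' \<in> principal_series x1 x2 l1 l2"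
    and "\<And>k. orthogonal_matrix k \<Longrightarrow> f' k = f k" and "g \<in> GL"
  shows "f' g = f g"
proof -
  obtain k A X B where k: "orthogonal_matrix k" "A \<in> GL" "B \<in> GL" "g = k ** upper_block A X B"
    using Iwasawa_block[OF assms(4)] by metis
  show ?thesis unfolding k(4)
    using principal_seriesD(2)[OF assms(1) orthogonal_GL[OF k(1)] k(2,3)]
      principal_seriesD(2)[OF assms(2) orthogonal_GL[OF k(1)] k(2,3)] assms(3)[OF k(1)] by simp
qed

section \<open>The continuation of the operator\<close>

lemma holomorphic_eq_of_eq_on_open:
  assumes "f holomorphic_on UNIV" "g holomorphic_on UNIV" "open S" "S \<noteq> {}" "\<And>z. z \<in> S \<Longrightarrow> f z = g z"
  shows "f z = g z"
  using analytic_continuation_open[of S UNIV f g z] assms by auto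

text \<open>
  The domain of convergence is given by one condition on \<open>m\<^sub>1\<close> and one on \<open>m\<^sub>2\<close> for fixed \<open>c\<close>. Extending first in \<open>m\<^sub>1\<close>
  and then in \<open>m\<^sub>2\<close> uses entire functions of a single variable that agree on a half plane.
\<close>

lemma B_continuation_unique:
  fixes f :: "'n::{finite,linorder} mat2 \<Rightarrow> complex"
  assumes f: "f \<in> principal_series x1 x2 l1 l2"
    and F: "B_continuation x1 x2 e f h F" and F': "B_continuation x1 x2 e f h F'"
  shows "F = F'"
proof -
  let ?n = "real CARD('n) / 2"
  have D: "F a b c = F' a b c" if "Re (a - c) > - real CARD('n) / 2" "Re (c - b) > - real CARD('n) / 2" for a b c
  proof -
    let ?f = "compact_transport ((l1 - a - l2 + b) / 2) ((l2 - b) / 2) f"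
    have "?f \<in> principal_series x1 x2 a b" "\<And>k. orthogonal_matrix k \<Longrightarrow> ?f k = f k"
      by (auto intro: compact_transport_principal_series[OF f] simp: compact_transport_orthogonal)
    then have "F a b c = B_integral x1 x2 e a b c ?f h" "F' a b c = B_integral x1 x2 e a b c ?f h"
      using F F' that unfolding B_continuation_def by blast+
    then show ?thesis by simp
  qed
  have hol: "(\<lambda>a. H a b c) holomorphic_on UNIV" "(\<lambda>b. H a b c) holomorphic_on UNIV" if "H \<in> {F, F'}" for H a b c
    using that F F' by (auto simp: B_continuation_def entire3_def)
  have 1: "F a b c = F' a b c" if "Re (c - b) > - ?n" for a b c
  proof (rule holomorphic_eq_of_eq_on_open[where f = "\<lambda>a. F a b c" and g = "\<lambda>a. F' a b c"])
    show "open {a. Re a > Re c - ?n}" by (rule open_halfspace_Re_gt)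
    have "c + 1 \<in> {a. Re a > Re c - ?n}" by simp
    then show "{a. Re a > Re c - ?n} \<noteq> {}" by blast
  qed (use hol D that in auto)
  have "F a b c = F' a b c" for a b c
  proof (rule holomorphic_eq_of_eq_on_open[where f = "\<lambda>b. F a b c" and g = "\<lambda>b. F' a b c"])
    show "open {b. Re b < Re c + ?n}" by (rule open_halfspace_Re_lt)
    have "c - 1 \<in> {b. Re b < Re c + ?n}" by simp
    then show "{b. Re b < Re c + ?n} \<noteq> {}" by blast
  qed (use hol 1 in auto)
  then show ?thesis by blast
qed

text \<open>
  The identity behind the symmetry between \<open>0\<close> and \<open>\<infinity>\<close>. The equivariance of \<open>f\<close> contributes the characters
  \<open>\<xi>\<^sub>1\<close> and \<open>\<xi>\<^sub>2\<close> of \<open>u\<close> and \<open>1/u\<close>; the first one cancels against \<open>\<xi>\<^sub>1 + \<eta>\<close>, and what remains is the character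
  \<open>\<xi>\<^sub>2 + \<eta>\<close> with exponent \<open>c - m\<^sub>2 + n/2\<close>. The factor \<open>1/u\<^sup>2\<close> comes from \<open>dt = - du/u\<^sup>2\<close>.
\<close>

lemma integrand_inversion:
  fixes h :: "'n::{finite,linorder} mat2"
  assumes f: "f \<in> principal_series x1 x2 m1 m2" and h: "h \<in> GL" and u: "u \<noteq> 0"
  shows "sabs (x1 + e) (m1 - c + of_nat CARD('n) / 2) (1 / u) * f (h ** (mat 1 + (1 / u) *\<^sub>R E_last)) / of_real \<bar>1 / u\<bar> / of_real (u\<^sup>2)
    = sabs (x2 + e) (c - m2 + of_nat CARD('n) / 2) u * f (h ** chart_at_infinity u) / of_real \<bar>u\<bar>"
proof -
  let ?n = "of_nat CARD('n) / 2 :: complex"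
  let ?g = "h ** (mat 1 + (1 / u) *\<^sub>R E_last)"
  obtain A X B :: "((real, 'n) vec, 'n) vec" where AB: "det A = 1 / (1 / u)" "det B = 1 / u"
    "chart_at_infinity (1 / (1 / u)) = (mat 1 + (1 / u) *\<^sub>R E_last) ** upper_block A X B"
    using shear_eq_chart_at_infinity[of "1 / u"] u by (metis divide_eq_0_iff zero_neq_one)
  have "h ** chart_at_infinity u = ?g ** upper_block A X B"
    using AB(3) by (simp add: matrix_mul_assoc)
  moreover have "f (?g ** upper_block A X B) = sabs x1 (- m1 - ?n) u * sabs x2 (- m2 + ?n) (1 / u) * f ?g"
    using principal_seriesD(2)[OF f shear_curve_GL[OF h], of A B "1 / u" X] u AB(1,2) by (simp add: GL_iff_det)
  ultimately have "sabs (x2 + e) (c - m2 + ?n) u * f (h ** chart_at_infinity u)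
     = (sabs (x2 + e) (c - m2 + ?n) u * sabs x1 (- m1 - ?n) u * sabs x2 (m2 - ?n) u) * f ?g"
    using u by (simp add: sabs_inverse)
  also have "\<dots> = sabs ((x2 + e) + x1 + x2) ((c - m2 + ?n) + (- m1 - ?n) + (m2 - ?n)) u * f ?g"
    by (simp only: sabs_add[OF u])
  also have "(x2 + e) + x1 + x2 = x1 + e" by (cases x1; cases x2; cases e) auto
  also have "(c - m2 + ?n) + (- m1 - ?n) + (m2 - ?n) = - (m1 - c + ?n)" by simp
  also have "sabs (x1 + e) \<dots> u = sabs (x1 + e) (m1 - c + ?n) (1 / u)" using u by (simp add: sabs_inverse)
  finally have eq: "sabs (x2 + e) (c - m2 + ?n) u * f (h ** chart_at_infinity u)
     = sabs (x1 + e) (m1 - c + ?n) (1 / u) * f ?g" .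
  have "\<bar>1 / u\<bar> * u\<^sup>2 = \<bar>u\<bar>" using u by (simp add: power2_eq_square abs_if)
  then show ?thesis unfolding eq divide_divide_eq_left of_real_mult[symmetric] by simp
qed

text \<open>
  On the domain of convergence the integral splits into the contributions of the two charts. The factors \<open>q\<^sup>w\<close> and \<open>q'\<^sup>w\<close> come
  from \<open>compact_transport\<close>, while the determinant is constant along both charts. Each Gamma factor belongs to the
  continuation of one contribution and multiplies the other one.
\<close>

lemma B_integral_eq_mellin:
  fixes h :: "'n::{finite,linorder} mat2" and f :: "'n mat2 \<Rightarrow> complex"
  defines "q \<equiv> \<lambda>t. det (gram (h ** (mat 1 + t *\<^sub>R E_last)))" and "q' \<equiv> \<lambda>u. det (gram (h ** chart_at_infinity u))"
  defines "a \<equiv> \<lambda>m1 c. m1 - c + of_nat CARD('n) / 2" and "b \<equiv> \<lambda>m2 c. c - m2 + of_nat CARD('n) / 2"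
  assumes h: "h \<in> GL_corner" and f: "f \<in> principal_series x1 x2 l1 l2"
    and g: "even_Cinf g" "\<And>t. f (h ** (mat 1 + t *\<^sub>R E_last)) + (- 1) ^ rep (x1 + e) * f (h ** (mat 1 + (- t) *\<^sub>R E_last))
      = of_real t ^ rep (x1 + e) * g t"
    and g': "even_Cinf g'" "\<And>u. f (h ** chart_at_infinity u) + (- 1) ^ rep (x2 + e) * f (h ** chart_at_infinity (- u))
      = of_real u ^ rep (x2 + e) * g' u"
    and f': "f' \<in> principal_series x1 x2 m1 m2" "\<And>k. orthogonal_matrix k \<Longrightarrow> f' k = f k"
    and conv: "Re (a m1 c) > 0" "Re (b m2 c) > 0"
  shows "B_integral x1 x2 e m1 m2 c f' h =
     of_real ((det h)\<^sup>2) powr ((l2 - m2) / 2) *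
      (rGamma ((b m2 c + of_nat (rep (x2 + e))) / 2) *
        even_weight.mellin_cont q g (a m1 c + of_nat (rep (x1 + e))) ((l1 - m1 - l2 + m2) / 2)
     + rGamma ((a m1 c + of_nat (rep (x1 + e))) / 2) *
        even_weight.mellin_cont q' g' (b m2 c + of_nat (rep (x2 + e))) ((l1 - m1 - l2 + m2) / 2))"
proof -
  interpret P: even_weight q unfolding q_def using h by (rule even_weight_shear)
  interpret R: even_weight q' unfolding q'_def using h by (rule even_weight_chart_at_infinity)
  have hGL: "h \<in> GL" using h by (simp add: GL_corner_def)
  let ?w = "(l1 - m1 - l2 + m2) / 2" and ?v = "(l2 - m2) / 2"
  let ?p = "\<lambda>t. h ** (mat 1 + t *\<^sub>R E_last)" and ?r = "\<lambda>u. h ** chart_at_infinity u"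
  define K where "K = complex_of_real ((det h)\<^sup>2) powr ?v"
  have GLs: "?p t \<in> GL" "?r t \<in> GL" for t using hGL by (rule shear_curve_GL, rule chart_at_infinity_GL)
  have f'_eq: "f' x = compact_transport ?w ?v f x" if "x \<in> GL" for x
    by (rule principal_series_eqI[OF compact_transport_principal_series[OF f] f'(1) _ that])
      (simp add: f'(2) compact_transport_orthogonal)
  have f'p: "f' (?p t) = (K * f (?p t)) * of_real (q t) powr ?w" for t
    by (simp add: f'_eq[OF GLs(1)] compact_transport_def q_def K_def det_mul det_shear)
  have f'r: "f' (?r u) = (K * f (?r u)) * of_real (q' u) powr ?w" for u
    by (simp add: f'_eq[OF GLs(2)] compact_transport_def q'_def K_def det_mul det_chart_at_infinity)
  have cf: "Cinf_on GL f" "Cinf_on GL f'" using principal_seriesD(1) f f'(1) by blast+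
  have Cp: "Cinf_on UNIV (\<lambda>t. k (?p t))" if "Cinf_on GL k" for k :: "'n mat2 \<Rightarrow> complex"
    using Cinf_on_affine[OF that, of h "h ** E_last"] GLs(1) by (simp add: shear_curve_affine)
  have Cr: "Cinf_on UNIV (\<lambda>t. k (?r t))" if "Cinf_on GL k" for k :: "'n mat2 \<Rightarrow> complex"
  proof -
    obtain A B where "\<And>u. ?r u = A + u *\<^sub>R B" using chart_at_infinity_affine[of h] by metis
    then show ?thesis using Cinf_on_affine[OF that, of A B] GLs(2) by simp
  qed
  have CK: "Cinf_on UNIV (\<lambda>t. K * k t)" if "Cinf_on UNIV k" for k :: "real \<Rightarrow> complex"
    by (rule Cinf_on_mult[OF open_UNIV _ that]) (simp add: Cinf_on_def Ck_on_const)
  have eK: "even_Cinf (\<lambda>t. K * k t)" if "even_Cinf k" for k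
    using that CK by (auto simp: even_Cinf_def)
  define G where "G t = sabs (x1 + e) (a m1 c) t * f' (?p t) / of_real \<bar>t\<bar>" for t
  define H where "H u = sabs (x2 + e) (b m2 c) u * f' (?r u) / of_real \<bar>u\<bar>" for u
  have GH: "G (1 / u) / of_real (u\<^sup>2) = H u" if "u \<noteq> 0" for u
    unfolding G_def H_def a_def b_def by (rule integrand_inversion[OF f'(1) hGL that])
  have G: "G absolutely_integrable_on {0<..<1}" "(\<lambda>u. G (- u)) absolutely_integrable_on {0<..<1}"
    "integral {0<..<1} G + integral {0<..<1} (\<lambda>u. G (- u)) = P.mellin (\<lambda>t. K * g t) (a m1 c + of_nat (rep (x1 + e))) ?w"
    unfolding G_def f'p
    by (rule P.signed_mellin[OF CK[OF Cp[OF cf(1)]] eK[OF g(1)] _ conv(1)];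
        simp only: mult.left_commute[of _ K] distrib_left[symmetric] g(2))+
  have H: "H absolutely_integrable_on {0<..<1}" "(\<lambda>u. H (- u)) absolutely_integrable_on {0<..<1}"
    "integral {0<..<1} H + integral {0<..<1} (\<lambda>u. H (- u)) = R.mellin (\<lambda>t. K * g' t) (b m2 c + of_nat (rep (x2 + e))) ?w"
    unfolding H_def f'r
    by (rule R.signed_mellin[OF CK[OF Cr[OF cf(1)]] eK[OF g'(1)] _ conv(2)];
        simp only: mult.left_commute[of _ K] distrib_left[symmetric] g'(2))+
  have H1: "G (1 / u) / of_real (u\<^sup>2) = H u" "G (- 1 / u) / of_real (u\<^sup>2) = H (- u)" if "u \<in> {0<..<1}" for u
    using GH[of u] GH[of "- u"] that by auto
  have HG: "(\<lambda>u. G (1 / u) / of_real (u\<^sup>2)) absolutely_integrable_on {0<..<1}"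
    "(\<lambda>u. G (- 1 / u) / of_real (u\<^sup>2)) absolutely_integrable_on {0<..<1}"
    by (rule absolutely_integrable_spike[OF H(1) negligible_empty], simp only: H1 Diff_empty)
      (rule absolutely_integrable_spike[OF H(2) negligible_empty], simp only: H1 Diff_empty)
  have ints: "integral {0<..<1} (\<lambda>u. G (1 / u) / of_real (u\<^sup>2)) = integral {0<..<1} H"
    "integral {0<..<1} (\<lambda>u. G (- 1 / u) / of_real (u\<^sup>2)) = integral {0<..<1} (\<lambda>u. H (- u))"
    by (rule integral_cong, simp only: H1)+
  have "continuous_on (- {0}) (\<lambda>t. f' (?p t))"
    by (rule continuous_on_subset[OF Cinf_on_continuous[OF Cp[OF cf(2)]]]) simp
  then have "continuous_on (- {0}) G"
    unfolding G_def[abs_def] by (intro continuous_intros continuous_on_sabs) auto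
  then have "(LBINT t:- {0}. G t) = integral (- {0}) G"
    by (intro borel_set_integral_eq_integral integral_inversion_split(1) G(1,2) HG) auto
  also have "\<dots> = (integral {0<..<1} G + integral {0<..<1} (\<lambda>u. G (- u))) + (integral {0<..<1} H + integral {0<..<1} (\<lambda>u. H (- u)))"
    unfolding integral_inversion_split(2)[OF G(1,2) HG] ints by (simp add: add.assoc)
  also have "\<dots> = K * (P.mellin g (a m1 c + of_nat (rep (x1 + e))) ?w + R.mellin g' (b m2 c + of_nat (rep (x2 + e))) ?w)"
    unfolding G(3) H(3) P.mellin_def R.mellin_def distrib_left integral_mult_right[symmetric]
    by (simp only: mult_ac)
  finally have I: "(LBINT t:- {0}. G t) = K * (P.mellin g (a m1 c + of_nat (rep (x1 + e))) ?w + R.mellin g' (b m2 c + of_nat (rep (x2 + e))) ?w)" .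
  have "B_integral x1 x2 e m1 m2 c f' h = rGamma ((a m1 c + of_nat (rep (x1 + e))) / 2) *
     rGamma ((b m2 c + of_nat (rep (x2 + e))) / 2) * (LBINT t:- {0}. G t)"
    unfolding B_integral_def G_def a_def b_def ..
  moreover have "P.mellin_cont g (a m1 c + of_nat (rep (x1 + e))) ?w
      = rGamma ((a m1 c + of_nat (rep (x1 + e))) / 2) * P.mellin g (a m1 c + of_nat (rep (x1 + e))) ?w"
    using conv by (intro P.mellin_cont_eq g(1)) simp
  moreover have "R.mellin_cont g' (b m2 c + of_nat (rep (x2 + e))) ?w
      = rGamma ((b m2 c + of_nat (rep (x2 + e))) / 2) * R.mellin g' (b m2 c + of_nat (rep (x2 + e))) ?w"
    using conv by (intro R.mellin_cont_eq g'(1)) simp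
  ultimately show ?thesis unfolding I K_def[symmetric] by (simp add: algebra_simps)
qed

text \<open>
  All arguments of \<open>mellin_cont\<close> in \<open>B_integral_eq_mellin\<close> are affine in the parameters, so its right-hand side is entire in each
  of them. The conclusion keeps the Gamma factors visible, since the vanishing is read off from them.
\<close>

lemma B_continuation_exists:
  fixes h :: "'n::{finite,linorder} mat2" and f :: "'n mat2 \<Rightarrow> complex"
  assumes h: "h \<in> GL_corner" and f: "f \<in> principal_series x1 x2 l1 l2"
  obtains F A A' where "B_continuation x1 x2 e f h F"
    "\<And>m1 m2 c. F m1 m2 c = rGamma ((c - m2 + of_nat CARD('n) / 2 + of_nat (rep (x2 + e))) / 2) * A m1 m2 c
      + rGamma ((m1 - c + of_nat CARD('n) / 2 + of_nat (rep (x1 + e))) / 2) * A' m1 m2 c"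
proof -
  let ?p = "\<lambda>t. h ** (mat 1 + t *\<^sub>R E_last)" and ?r = "\<lambda>u. h ** chart_at_infinity u"
  define q where "q t = det (gram (?p t))" for t
  define q' where "q' u = det (gram (?r u))" for u
  have "even_weight q" "even_weight q'"
    unfolding q_def[abs_def] q'_def[abs_def] by (rule even_weight_shear[OF h], rule even_weight_chart_at_infinity[OF h])
  then interpret P: even_weight q + R: even_weight q' .
  have hGL: "h \<in> GL" using h by (simp add: GL_corner_def)
  have Cf: "Cinf_on GL f" using principal_seriesD(1)[OF f] .
  have "Cinf_on UNIV (\<lambda>t. f (?p t))"
    using Cinf_on_affine[OF Cf, of h "h ** E_last"] shear_curve_GL[OF hGL] by (simp add: shear_curve_affine)
  from parity_part[OF this] obtain g where g: "even_Cinf g"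
    "\<And>t. f (?p t) + (- 1) ^ rep (x1 + e) * f (?p (- t)) = of_real t ^ rep (x1 + e) * g t" by blast
  obtain M N where MN: "\<And>u. ?r u = M + u *\<^sub>R N" using chart_at_infinity_affine[of h] by metis
  then have "Cinf_on UNIV (\<lambda>t. f (?r t))" using Cinf_on_affine[OF Cf, of M N] chart_at_infinity_GL[OF hGL] by simp
  from parity_part[OF this] obtain g' where g': "even_Cinf g'"
    "\<And>u. f (?r u) + (- 1) ^ rep (x2 + e) * f (?r (- u)) = of_real u ^ rep (x2 + e) * g' u" by blast
  define D where "D m2 = complex_of_real ((det h)\<^sup>2) powr ((l2 - m2) / 2)" for m2
  define s where "s m1 c = m1 - c + of_nat CARD('n) / 2 + of_nat (rep (x1 + e))" for m1 c :: complex
  define s' where "s' m2 c = c - m2 + of_nat CARD('n) / 2 + of_nat (rep (x2 + e))" for m2 c :: complex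
  define w where "w m1 m2 = (l1 - m1 - l2 + m2) / 2" for m1 m2
  define A where "A m1 m2 c = D m2 * P.mellin_cont g (s m1 c) (w m1 m2)" for m1 m2 c
  define A' where "A' m1 m2 c = D m2 * R.mellin_cont g' (s' m2 c) (w m1 m2)" for m1 m2 c
  define F where "F m1 m2 c = rGamma (s' m2 c / 2) * A m1 m2 c + rGamma (s m1 c / 2) * A' m1 m2 c" for m1 m2 c
  have dh: "(det h)\<^sup>2 > 0" using hGL by (simp add: GL_iff_det)
  have D_hol: "(\<lambda>m2. D m2) holomorphic_on UNIV"
    unfolding D_def using dh by (intro holomorphic_intros) auto
  have "entire3 F"
    unfolding entire3_def
  proof (intro conjI allI)
    have "continuous_on UNIV (\<lambda>x. F (fst x) (fst (snd x)) (snd (snd x)))"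
      unfolding F_def A_def A'_def D_def s_def s'_def w_def using dh
      by (intro continuous_intros P.mellin_cont_continuous R.mellin_cont_continuous g(1) g'(1)) auto
    then show "continuous_on UNIV (\<lambda>(a, b, c). F a b c)" by (simp add: case_prod_unfold)
  next
    fix b c
    have "(\<lambda>a. A a b c) holomorphic_on UNIV" unfolding A_def
      by (intro holomorphic_intros P.mellin_cont_holomorphic_affine[OF g(1), where a = "s 0 c" and b = 1 and c = "w 0 b" and d = "-1/2"])
        (simp_all add: s_def w_def field_simps)
    moreover have "(\<lambda>a. A' a b c) holomorphic_on UNIV" unfolding A'_def
      by (intro holomorphic_intros R.mellin_cont_holomorphic_affine[OF g'(1), where a = "s' b c" and b = 0 and c = "w 0 b" and d = "-1/2"])
        (simp_all add: s'_def w_def field_simps)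
    ultimately show "(\<lambda>a. F a b c) holomorphic_on UNIV"
      unfolding F_def s_def s'_def by (intro holomorphic_intros) auto
  next
    fix a c
    have "(\<lambda>b. A a b c) holomorphic_on UNIV" unfolding A_def
      by (intro holomorphic_intros D_hol P.mellin_cont_holomorphic_affine[OF g(1), where a = "s a c" and b = 0 and c = "w a 0" and d = "1/2"])
        (simp_all add: s_def w_def field_simps)
    moreover have "(\<lambda>b. A' a b c) holomorphic_on UNIV" unfolding A'_def
      by (intro holomorphic_intros D_hol R.mellin_cont_holomorphic_affine[OF g'(1), where a = "s' 0 c" and b = "-1" and c = "w a 0" and d = "1/2"])
        (simp_all add: s'_def w_def field_simps)
    ultimately show "(\<lambda>b. F a b c) holomorphic_on UNIV"
      unfolding F_def s_def s'_def by (intro holomorphic_intros) auto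
  next
    fix a b
    have "(\<lambda>c. A a b c) holomorphic_on UNIV" unfolding A_def
      by (intro holomorphic_intros P.mellin_cont_holomorphic_affine[OF g(1), where a = "s a 0" and b = "-1" and c = "w a b" and d = 0])
        (simp_all add: s_def w_def field_simps)
    moreover have "(\<lambda>c. A' a b c) holomorphic_on UNIV" unfolding A'_def
      by (intro holomorphic_intros R.mellin_cont_holomorphic_affine[OF g'(1), where a = "s' b 0" and b = 1 and c = "w a b" and d = 0])
        (simp_all add: s'_def w_def field_simps)
    ultimately show "(\<lambda>c. F a b c) holomorphic_on UNIV"
      unfolding F_def s_def s'_def by (intro holomorphic_intros) auto
  qed
  moreover have "F m1 m2 c = B_integral x1 x2 e m1 m2 c f' h"
    if "Re (m1 - c) > - real CARD('n) / 2" "Re (c - m2) > - real CARD('n) / 2"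
      "f' \<in> principal_series x1 x2 m1 m2" "\<forall>k. orthogonal_matrix k \<longrightarrow> f' k = f k" for m1 m2 c f'
  proof -
    have "Re (m1 - c + of_nat CARD('n) / 2) > 0" "Re (c - m2 + of_nat CARD('n) / 2) > 0"
      using that(1,2) by simp_all
    from B_integral_eq_mellin[OF h f g g' that(3) _ this] that(4)
    show ?thesis
      unfolding F_def A_def A'_def D_def s_def s'_def w_def q_def[abs_def] q'_def[abs_def]
      by (simp only: distrib_left mult_ac)
  qed
  ultimately have "B_continuation x1 x2 e f h F" unfolding B_continuation_def by blast
  then show thesis using that[of F A A'] by (simp add: F_def s_def s'_def)
qed

lemma rGamma_neg_evens: "z \<in> neg_evens \<Longrightarrow> rGamma (z / 2) = 0"
  by (auto simp: neg_evens_def rGamma_eq_zero_iff)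

theorem proposition3p3:
  fixes x1 x2 e :: bit and l1 l2 nu :: complex
  assumes "l1 - nu + of_nat CARD('n::{finite,linorder}) / 2 + of_nat (rep (x1 + e)) \<in> neg_evens"
    and "nu - l2 + of_nat CARD('n) / 2 + of_nat (rep (x2 + e)) \<in> neg_evens"
  shows "\<forall>f \<in> (principal_series x1 x2 l1 l2 :: ('n mat2 \<Rightarrow> complex) set).
           \<forall>h \<in> GL_corner. B_op x1 x2 e l1 l2 nu f h = 0"
proof (intro ballI)
  fix f :: "'n mat2 \<Rightarrow> complex" and h :: "'n mat2"
  assume f: "f \<in> principal_series x1 x2 l1 l2" and h: "h \<in> GL_corner"
  from B_continuation_exists[OF h f, of e] obtain F A A' where F: "B_continuation x1 x2 e f h F"
    "\<And>m1 m2 c. F m1 m2 c = rGamma ((c - m2 + of_nat CARD('n) / 2 + of_nat (rep (x2 + e))) / 2) * A m1 m2 c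
      + rGamma ((m1 - c + of_nat CARD('n) / 2 + of_nat (rep (x1 + e))) / 2) * A' m1 m2 c" by blast
  have "(THE F. B_continuation x1 x2 e f h F) = F"
    using F(1) B_continuation_unique[OF f] by (intro the_equality) blast+
  then show "B_op x1 x2 e l1 l2 nu f h = 0"
    by (simp only: B_op_def F(2) rGamma_neg_evens[OF assms(1)] rGamma_neg_evens[OF assms(2)]
        mult_zero_left add_0)
qed

end
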